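(* Let $(\Omega,\mathcal{F},\mathbb{P})$ be a probability space and let $\mathcal{G}_1,\mathcal{G}_2$ be sub-$\sigma$-fields of $\mathcal{F}$. Let $T_1=\mathbb{E}[\,\cdot\mid\mathcal{G}_1]$ and $T_2=\mathbb{E}[\,\cdot\mid\mathcal{G}_2]$, and extend this to a sequence by setting $T_{2k-1}=T_1$ and $T_{2k}=T_2$ for all positive integers $k$. Let $S_n=T_n\cdots T_2T_1$ for $n\ge 1$. Then for all $X\in L_2(\Omega,\mathcal{F},\mathbb{P})$, $$\lim_{n\to\infty}S_n(X)=\mathbb{E}\left[X\mid\bar{\mathcal{G}_1}\cap\bar{\mathcal{G}_2}\right]$$ both in $L_2$ and almost surely.
   Context: For a sub-$\sigma$-field $\mathcal{G}\subset\mathcal{F}$, $\mathbb{E}[X\mid\mathcal{G}]$ denotes the conditional expectation of $X$ with respect to $\mathcal{G}$ under $\mathbb{P}$, and $\bar{\mathcal{G}}$ denotes the completion of $\mathcal{G}$ with respect to $\mathbb{P}$ (the $\sigma$-field generated by $\mathcal{G}$ together with the $\mathbb{P}$-null sets). *)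

theory Defs
  imports "HOL-Probability.Probability"
begin

definition square_integrable :: "'a measure \<Rightarrow> ('a \<Rightarrow> real) \<Rightarrow> bool" where
  "square_integrable M f \<longleftrightarrow>
     f \<in> borel_measurable M \<and> integrable M (\<lambda>x. (f x)\<^sup>2)"

definition L2_norm_on :: "'a measure \<Rightarrow> ('a \<Rightarrow> real) \<Rightarrow> real" where
  "L2_norm_on M f = sqrt (\<integral>x. (f x)\<^sup>2 \<partial>M)"

(* The integral of a non-integrable function is 0, so membership in L2 has to be
   part of the notion of convergence. *)
definition L2_converges :: "'a measure \<Rightarrow> (nat \<Rightarrow> 'a \<Rightarrow> real) \<Rightarrow> ('a \<Rightarrow> real) \<Rightarrow> bool" where
  "L2_converges M f g \<longleftrightarrow>
     (\<forall>n. square_integrable M (f n)) \<and> square_integrable M g \<and>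
     (\<lambda>n. L2_norm_on M (\<lambda>x. f n x - g x)) \<longlonglongrightarrow> 0"

(* A sub-sigma-field is represented by a measure of which only the space and the sets
   matter. The null sets adjoined are the measurable ones (M need not be complete), so
   the completed field is again a sub-sigma-field of M. *)
definition null_completion :: "'a measure \<Rightarrow> 'a measure \<Rightarrow> 'a measure" where
  "null_completion M G = sigma (space M) (sets G \<union> null_sets M)"

definition inter_field :: "'a measure \<Rightarrow> 'a measure \<Rightarrow> 'a measure \<Rightarrow> 'a measure" where
  "inter_field M A B = sigma (space M) (sets A \<inter> sets B)"

(* The operators of the sequence are indexed from 1; the value at 0 is not used. *)
definition alt_cond_exp ::
  "'a measure \<Rightarrow> 'a measure \<Rightarrow> 'a measure \<Rightarrow> nat \<Rightarrow> ('a \<Rightarrow> real) \<Rightarrow> 'a \<Rightarrow> real" where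
  "alt_cond_exp M G1 G2 n = (if odd n then real_cond_exp M G1 else real_cond_exp M G2)"

primrec iter_ops ::
  "(nat \<Rightarrow> ('a \<Rightarrow> real) \<Rightarrow> 'a \<Rightarrow> real) \<Rightarrow> nat \<Rightarrow> ('a \<Rightarrow> real) \<Rightarrow> 'a \<Rightarrow> real" where
  "iter_ops T 0 X = X"
| "iter_ops T (Suc n) X = T (Suc n) (iter_ops T n X)"

lemma subalgebra_null_completion:
  assumes "subalgebra M G"
  shows "subalgebra M (null_completion M G)"
proof -
  have sub: "sets G \<union> null_sets M \<subseteq> sets M"
    using assms by (auto simp: subalgebra_def)
  then have "sets G \<union> null_sets M \<subseteq> Pow (space M)"
    using sets.space_closed by blast
  moreover have "sigma_sets (space M) (sets G \<union> null_sets M) \<subseteq> sets M"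
    using sub by (rule sets.sigma_sets_subset)
  ultimately show ?thesis
    by (simp add: subalgebra_def null_completion_def space_measure_of_conv)
qed

lemma sets_inter_field:
  assumes "subalgebra M A" "subalgebra M B"
  shows "sets (inter_field M A B) = sets A \<inter> sets B"
proof -
  have sp: "space A = space M" "space B = space M"
    using assms by (auto simp: subalgebra_def)
  have "sets A \<inter> sets B \<subseteq> Pow (space M)"
    using sets.space_closed[of A] sp by auto
  moreover have "sigma_sets (space M) (sets A \<inter> sets B) = sets A \<inter> sets B"
  proof
    show "sigma_sets (space M) (sets A \<inter> sets B) \<subseteq> sets A \<inter> sets B"
      using sets.sigma_sets_subset[of "sets A \<inter> sets B" A]
        sets.sigma_sets_subset[of "sets A \<inter> sets B" B] sp by auto
  qed auto
  ultimately show ?thesis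
    by (simp add: inter_field_def)
qed

end

theory Submission
  imports Defs
begin

text \<open>
  \<^bold>\<open>Reduction to powers of one operator.\<close> Adjoining the null sets to \<open>G1\<close> and \<open>G2\<close> changes the
  conditional expectations only on null sets, so write \<open>F1\<close>, \<open>F2\<close> for the completed fields, \<open>T1\<close>,
  \<open>T2\<close> for their conditional expectations and \<open>H\<close> for the intersection of \<open>F1\<close> and \<open>F2\<close>.
  Since \<open>T1\<close> is idempotent, the iterates of odd index are \<open>A ^ n\<close> applied to \<open>T1 X\<close>, where
  \<open>A = T1 T2 T1\<close>; those of even index have the same shape with \<open>F1\<close> and \<open>F2\<close> exchanged and \<open>T1 X\<close>
  in place of \<open>X\<close>. On \<open>L\<^sub>2\<close> the operator \<open>A\<close> is linear, monotone, symmetric, preserves constants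
  and satisfies \<open>\<parallel>A f\<parallel>\<^sup>2 \<le> \<langle>A f, f\<rangle>\<close>. The powers of any such operator converge in mean square and
  almost surely; this is the core of the argument.

  \<^bold>\<open>Mean-square convergence.\<close> The moments \<open>a n = \<langle>A ^ n f, f\<rangle>\<close> are nonnegative and decreasing, and
  the squared distance of \<open>A ^ m f\<close> and \<open>A ^ n f\<close> is \<open>a (2 * m) - 2 * a (m + n) + a (2 * n)\<close>.
  Hence \<open>A ^ n f\<close> is Cauchy, and its limit \<open>g\<close> is fixed by \<open>A\<close> (\<open>pow_L2_converges\<close>).

  \<^bold>\<open>Almost sure convergence.\<close> Let \<open>u\<close> be square-integrable. The maximal ergodic theorem bounds the
  averages of \<open>A ^ k u\<close> in weak type (\<open>ergodic_maximal_inequality\<close>). The difference between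
  \<open>A ^ n u\<close> and the average of \<open>u, A u, ..., A ^ n u\<close> is a weighted sum of increments, which
  the Cauchy--Schwarz inequality bounds by the square function
  \<open>\<Sum>k. (k + 1) * (A ^ k u - A ^ (k + 1) u)\<^sup>2\<close>. Its integral is at most \<open>\<parallel>u\<parallel>\<^sup>2\<close>, by summation by
  parts on the second differences of the moments (\<open>increment_square_sum\<close>). Together these give a
  bound on the probability that some \<open>A ^ n u\<close> is large, which tends to \<open>0\<close> with \<open>\<parallel>u\<parallel>\<close>
  (\<open>maximal_inequality\<close>). For \<open>u = A ^ N f - g\<close> one has \<open>A ^ n u = A ^ (n + N) f - g\<close>, so the
  inequality controls the whole tail of the sequence, and almost sure convergence follows.

  \<^bold>\<open>Identification of the limit.\<close> If \<open>A g = g\<close>, then all inequalities in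
  \<open>\<parallel>A g\<parallel> \<le> \<parallel>T2 T1 g\<parallel> \<le> \<parallel>T1 g\<parallel> \<le> \<parallel>g\<parallel>\<close> are equalities, so \<open>T1 g = g\<close> and \<open>T2 g = g\<close> almost
  everywhere. As \<open>F1\<close> and \<open>F2\<close> contain the null sets, \<open>g\<close> is measurable with respect to \<open>H\<close>. On
  the other hand conditioning on \<open>H\<close> absorbs \<open>T1\<close> and \<open>T2\<close> and is continuous on \<open>L\<^sub>2\<close>, so the limit
  \<open>g\<close> of \<open>A ^ n f\<close> is the conditional expectation of \<open>f\<close> given \<open>H\<close>. For \<open>f = T1 X\<close> this is the
  conditional expectation of \<open>X\<close> itself.
\<close>

section \<open>Square-integrable functions on a probability space\<close>

lemma square_integrable_measurable [measurable_dest]: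
  "square_integrable M f \<Longrightarrow> f \<in> borel_measurable M"
  by (simp add: square_integrable_def)

lemma square_integrable_power2: "square_integrable M f \<Longrightarrow> integrable M (\<lambda>x. (f x)\<^sup>2)"
  by (simp add: square_integrable_def)

lemma square_integrable_mult:
  assumes "square_integrable M f" "square_integrable M g"
  shows "integrable M (\<lambda>x. f x * g x)"
proof (rule Bochner_Integration.integrable_bound)
  show "integrable M (\<lambda>x. (f x)\<^sup>2 + (g x)\<^sup>2)"
    using assms by (simp add: square_integrable_def)
  show "(\<lambda>x. f x * g x) \<in> borel_measurable M"
    using assms by (auto simp: square_integrable_def)
  have "\<bar>f x * g x\<bar> \<le> \<bar>(f x)\<^sup>2 + (g x)\<^sup>2\<bar>" for x
  proof -
    have "2 * (\<bar>f x\<bar> * \<bar>g x\<bar>) \<le> \<bar>f x\<bar>\<^sup>2 + \<bar>g x\<bar>\<^sup>2"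
      using zero_le_power2[of "\<bar>f x\<bar> - \<bar>g x\<bar>"] unfolding power2_diff by linarith
    moreover have "0 \<le> \<bar>f x\<bar> * \<bar>g x\<bar>" by simp
    ultimately show ?thesis by (simp only: abs_mult power2_abs)
  qed
  then show "AE x in M. norm (f x * g x) \<le> norm ((f x)\<^sup>2 + (g x)\<^sup>2)"
    by simp
qed

lemma square_integrable_bound:
  assumes "square_integrable M f" "g \<in> borel_measurable M" "AE x in M. \<bar>g x\<bar> \<le> \<bar>f x\<bar>"
  shows "square_integrable M g"
  unfolding square_integrable_def
proof
  show "integrable M (\<lambda>x. (g x)\<^sup>2)"
  proof (rule Bochner_Integration.integrable_bound)
    show "integrable M (\<lambda>x. (f x)\<^sup>2)" using assms by (simp add: square_integrable_def)
    show "AE x in M. norm ((g x)\<^sup>2) \<le> norm ((f x)\<^sup>2)"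
      using assms(3) by eventually_elim (simp add: abs_le_square_iff)
  qed (use assms(2) in measurable)
qed (fact assms(2))

lemma square_integrable_add:
  assumes "square_integrable M f" "square_integrable M g"
  shows "square_integrable M (\<lambda>x. f x + g x)"
  using assms square_integrable_mult[OF assms]
  by (auto simp: square_integrable_def power2_sum mult.assoc)

lemma square_integrable_cmult:
  "square_integrable M f \<Longrightarrow> square_integrable M (\<lambda>x. c * f x)"
  by (auto simp: square_integrable_def power_mult_distrib)

lemma square_integrable_diff:
  assumes "square_integrable M f" "square_integrable M g"
  shows "square_integrable M (\<lambda>x. f x - g x)"
  using square_integrable_add[OF assms(1) square_integrable_cmult[OF assms(2), of "-1"]] by simp

lemma square_integrable_abs: "square_integrable M f \<Longrightarrow> square_integrable M (\<lambda>x. \<bar>f x\<bar>)"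
  by (auto simp: square_integrable_def)

lemma square_integrable_zero: "square_integrable M (\<lambda>x. 0)"
  by (simp add: square_integrable_def)

lemma square_integrable_sum:
  "(\<And>k. square_integrable M (h k)) \<Longrightarrow> square_integrable M (\<lambda>x. \<Sum>k<(n::nat). h k x)"
  by (induction n) (simp_all add: square_integrable_zero square_integrable_add)

lemma square_integrable_max:
  assumes "square_integrable M f"
  shows "square_integrable M (\<lambda>x. max 0 (f x))"
  using assms by (rule square_integrable_bound) (use assms in \<open>auto simp: square_integrable_def\<close>)

lemma integral_square_diff:
  assumes "square_integrable M f" "square_integrable M g"
  shows "(\<integral>x. (f x - g x)\<^sup>2 \<partial>M)
    = (\<integral>x. (f x)\<^sup>2 \<partial>M) - 2 * (\<integral>x. f x * g x \<partial>M) + (\<integral>x. (g x)\<^sup>2 \<partial>M)"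
proof -
  have "(\<integral>x. (f x - g x)\<^sup>2 \<partial>M) = (\<integral>x. (f x)\<^sup>2 - 2 * (f x * g x) + (g x)\<^sup>2 \<partial>M)"
    by (simp add: power2_diff algebra_simps)
  then show ?thesis
    using assms square_integrable_mult[OF assms] by (simp add: square_integrable_power2)
qed

lemma integral_square_diff_cong:
  fixes f g f' g' :: "'a \<Rightarrow> real"
  assumes [measurable]: "f \<in> borel_measurable M" "g \<in> borel_measurable M"
      "f' \<in> borel_measurable M" "g' \<in> borel_measurable M"
    and "AE x in M. f x = f' x" "AE x in M. g x = g' x"
  shows "(\<integral>x. (f x - g x)\<^sup>2 \<partial>M) = (\<integral>x. (f' x - g' x)\<^sup>2 \<partial>M)"
proof (rule integral_cong_AE)
  show "AE x in M. (f x - g x)\<^sup>2 = (f' x - g' x)\<^sup>2"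
    using assms(5,6) by eventually_elim simp
qed measurable

lemma integral_square_zero:
  assumes "square_integrable M f" "(\<integral>x. (f x)\<^sup>2 \<partial>M) \<le> 0"
  shows "AE x in M. f x = 0"
proof -
  have "(\<integral>x. (f x)\<^sup>2 \<partial>M) = 0"
    using assms(2) by (simp add: antisym)
  then show ?thesis
    using integral_nonneg_eq_0_iff_AE[of M "\<lambda>x. (f x)\<^sup>2"] assms(1)
    by (simp add: square_integrable_power2)
qed

lemma integral_square_triangle:
  assumes "square_integrable M f" "square_integrable M g"
  shows "(\<integral>x. (f x + g x)\<^sup>2 \<partial>M) \<le> 2 * (\<integral>x. (f x)\<^sup>2 \<partial>M) + 2 * (\<integral>x. (g x)\<^sup>2 \<partial>M)"
proof -
  have "(\<integral>x. (f x + g x)\<^sup>2 \<partial>M) \<le> (\<integral>x. 2 * (f x)\<^sup>2 + 2 * (g x)\<^sup>2 \<partial>M)"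
  proof (rule integral_mono)
    show "(f x + g x)\<^sup>2 \<le> 2 * (f x)\<^sup>2 + 2 * (g x)\<^sup>2" for x
      using zero_le_power2[of "f x - g x"] by (simp add: power2_sum power2_diff)
  qed (use assms in \<open>auto intro!: square_integrable_power2 square_integrable_add\<close>)
  then show ?thesis using assms by (simp add: square_integrable_power2)
qed

context prob_space
begin

lemma square_integrable_const: "square_integrable M (\<lambda>x. c)"
  by (simp add: square_integrable_def)

lemma square_integrable_imp_integrable: "square_integrable M f \<Longrightarrow> integrable M f"
  using square_integrable_mult[OF _ square_integrable_const, of f 1] by simp

lemma integral_abs_le_L2:
  assumes "square_integrable M f"
  shows "(\<integral>x. \<bar>f x\<bar> \<partial>M) \<le> sqrt (\<integral>x. (f x)\<^sup>2 \<partial>M)"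
proof (rule real_le_rsqrt)
  have "0 \<le> variance (\<lambda>x. \<bar>f x\<bar>)" by (rule variance_positive)
  also have "\<dots> = (\<integral>x. (f x)\<^sup>2 \<partial>M) - (\<integral>x. \<bar>f x\<bar> \<partial>M)\<^sup>2"
    using assms square_integrable_imp_integrable[OF assms]
    by (subst variance_eq) (simp_all add: square_integrable_def)
  finally show "(\<integral>x. \<bar>f x\<bar> \<partial>M)\<^sup>2 \<le> (\<integral>x. (f x)\<^sup>2 \<partial>M)" by simp
qed

lemma prob_Union_incseq_le:
  assumes "range E \<subseteq> events" "incseq E" "\<And>n. prob (E n) \<le> c"
  shows "prob (\<Union>n. E n) \<le> c"
  using finite_Lim_measure_incseq[OF assms(1,2)] assms(3) by (intro LIMSEQ_le_const2) auto

text \<open>Completeness of \<open>L\<^sub>2\<close> (Riesz--Fischer): a subsequence converges almost everywhere, and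
  Fatou's lemma identifies its pointwise limit as the mean-square limit.\<close>

lemma L2_complete:
  assumes sq: "\<And>n. square_integrable M (s n)"
    and Cauchy: "\<And>e. e > 0 \<Longrightarrow> \<exists>N. \<forall>m\<ge>N. \<forall>n\<ge>N. (\<integral>x. (s m x - s n x)\<^sup>2 \<partial>M) \<le> e"
  obtains g where "square_integrable M g" "(\<lambda>n. \<integral>x. (s n x - g x)\<^sup>2 \<partial>M) \<longlonglongrightarrow> 0"
proof -
  have [measurable]: "s n \<in> borel_measurable M" for n
    using sq[of n] by (simp add: square_integrable_def)
  have L1: "\<exists>N. \<forall>i\<ge>N. \<forall>j\<ge>N. (\<integral>x. norm (s i x - s j x) \<partial>M) < e" if "e > 0" for e
  proof -
    obtain N where N: "\<forall>m\<ge>N. \<forall>n\<ge>N. (\<integral>x. (s m x - s n x)\<^sup>2 \<partial>M) \<le> (e/2)\<^sup>2"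
      using Cauchy[of "(e/2)\<^sup>2"] \<open>e > 0\<close> by auto
    have "(\<integral>x. norm (s i x - s j x) \<partial>M) < e" if "i \<ge> N" "j \<ge> N" for i j
    proof -
      have "(\<integral>x. norm (s i x - s j x) \<partial>M) \<le> sqrt (\<integral>x. (s i x - s j x)\<^sup>2 \<partial>M)"
        using integral_abs_le_L2[OF square_integrable_diff[OF sq sq]] by simp
      also have "\<dots> \<le> sqrt ((e/2)\<^sup>2)" using N that by (intro real_sqrt_le_mono) simp
      also have "\<dots> < e" using \<open>e > 0\<close> by simp
      finally show ?thesis .
    qed
    then show ?thesis by blast
  qed
  obtain r where r: "strict_mono r" "AE x in M. Cauchy (\<lambda>i. s (r i) x)"
    using cauchy_L1_AE_cauchy_subseq[OF square_integrable_imp_integrable[OF sq] L1] by blast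
  define g where "g x = lim (\<lambda>i. s (r i) x)" for x
  have [measurable]: "g \<in> borel_measurable M" unfolding g_def by measurable
  have conv: "AE x in M. (\<lambda>i. s (r i) x) \<longlonglongrightarrow> g x"
    using r(2) by eventually_elim (simp add: g_def Cauchy_convergent_iff convergent_LIMSEQ_iff)
  have fatou: "(\<integral>\<^sup>+x. ennreal ((s m x - g x)\<^sup>2) \<partial>M) \<le> ennreal e"
    if N: "\<forall>m\<ge>N. \<forall>n\<ge>N. (\<integral>x. (s m x - s n x)\<^sup>2 \<partial>M) \<le> e" and "m \<ge> N" for N m e
  proof -
    have "(\<integral>\<^sup>+x. ennreal ((s m x - g x)\<^sup>2) \<partial>M)
        = (\<integral>\<^sup>+x. liminf (\<lambda>i. ennreal ((s m x - s (r i) x)\<^sup>2)) \<partial>M)"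
    proof (rule nn_integral_cong_AE, use conv in eventually_elim)
      case (elim x)
      have "(\<lambda>i. ennreal ((s m x - s (r i) x)\<^sup>2)) \<longlonglongrightarrow> ennreal ((s m x - g x)\<^sup>2)"
        by (intro tendsto_intros tendsto_ennrealI elim)
      then show ?case by (rule lim_imp_Liminf[OF trivial_limit_sequentially, symmetric])
    qed
    also have "\<dots> \<le> liminf (\<lambda>i. \<integral>\<^sup>+x. ennreal ((s m x - s (r i) x)\<^sup>2) \<partial>M)"
      by (rule nn_integral_liminf) measurable
    also have "\<dots> \<le> liminf (\<lambda>i. ennreal e)"
    proof (rule Liminf_mono, rule eventually_sequentiallyI[of N])
      fix i assume "N \<le> i"
      then have "N \<le> r i" using seq_suble[OF r(1), of i] by simp
      have "(\<integral>\<^sup>+x. ennreal ((s m x - s (r i) x)\<^sup>2) \<partial>M)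
          = ennreal (\<integral>x. (s m x - s (r i) x)\<^sup>2 \<partial>M)"
        by (intro nn_integral_eq_integral square_integrable_power2 square_integrable_diff sq) simp
      also have "\<dots> \<le> ennreal e" using N \<open>N \<le> r i\<close> \<open>m \<ge> N\<close> by (intro ennreal_leI) simp
      finally show "(\<integral>\<^sup>+x. ennreal ((s m x - s (r i) x)\<^sup>2) \<partial>M) \<le> ennreal e" .
    qed
    also have "\<dots> = ennreal e" by (simp add: Liminf_const)
    finally show ?thesis .
  qed
  obtain N1 where N1: "\<forall>m\<ge>N1. \<forall>n\<ge>N1. (\<integral>x. (s m x - s n x)\<^sup>2 \<partial>M) \<le> 1"
    using Cauchy[of 1] by auto
  have "integrable M (\<lambda>x. (s N1 x - g x)\<^sup>2)"
    using fatou[OF N1 order_refl] by (intro integrableI_bounded) (auto simp: top_unique order_le_less_trans)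
  then have "square_integrable M (\<lambda>x. s N1 x - g x)"
    by (simp add: square_integrable_def)
  then have g: "square_integrable M g"
    using square_integrable_diff[OF sq[of N1]] by fastforce
  have "(\<lambda>n. \<integral>x. (s n x - g x)\<^sup>2 \<partial>M) \<longlonglongrightarrow> 0"
  proof (rule LIMSEQ_I)
    fix e :: real assume "e > 0"
    obtain N where N: "\<forall>m\<ge>N. \<forall>n\<ge>N. (\<integral>x. (s m x - s n x)\<^sup>2 \<partial>M) \<le> e/2"
      using Cauchy[of "e/2"] \<open>e > 0\<close> by auto
    have "(\<integral>x. (s n x - g x)\<^sup>2 \<partial>M) \<le> e/2" if "n \<ge> N" for n
    proof -
      have "ennreal (\<integral>x. (s n x - g x)\<^sup>2 \<partial>M) = (\<integral>\<^sup>+x. ennreal ((s n x - g x)\<^sup>2) \<partial>M)"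
        by (intro nn_integral_eq_integral[symmetric] square_integrable_power2 square_integrable_diff sq g) simp
      also have "\<dots> \<le> ennreal (e/2)" using fatou[OF N that] .
      finally show ?thesis using \<open>e > 0\<close> by simp
    qed
    then show "\<exists>no. \<forall>n\<ge>no. norm ((\<integral>x. (s n x - g x)\<^sup>2 \<partial>M) - 0) < e"
      using \<open>e > 0\<close> by (intro exI[of _ N]) force
  qed
  with g show ?thesis by (rule that)
qed

end

section \<open>Symmetric Markov operators\<close>

text \<open>An operator on square-integrable functions that is linear, monotone, preserves constants, is
  symmetric and lies between \<open>0\<close> and the identity in the order of symmetric operators. The last
  property is encoded by \<open>firm\<close>, i.e. \<open>\<parallel>A f\<parallel>\<^sup>2 \<le> \<langle>A f, f\<rangle>\<close>, which gives positivity and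
  contractivity at once. The operator acts on functions rather than on classes modulo null sets;
  accordingly every law is required almost everywhere only.\<close>
locale symmetric_markov_operator = prob_space M for M :: "'a measure" +
  fixes A :: "('a \<Rightarrow> real) \<Rightarrow> 'a \<Rightarrow> real"
  assumes sq: "square_integrable M f \<Longrightarrow> square_integrable M (A f)"
    and lin: "square_integrable M f \<Longrightarrow> square_integrable M g \<Longrightarrow>
      AE x in M. A (\<lambda>x. f x + c * g x) x = A f x + c * A g x"
    and mono: "square_integrable M f \<Longrightarrow> square_integrable M g \<Longrightarrow> AE x in M. f x \<le> g x \<Longrightarrow>
      AE x in M. A f x \<le> A g x"
    and one: "AE x in M. A (\<lambda>_. 1) x = 1"
    and sym: "square_integrable M f \<Longrightarrow> square_integrable M g \<Longrightarrow>
      (\<integral>x. A f x * g x \<partial>M) = (\<integral>x. f x * A g x \<partial>M)"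
    and firm: "square_integrable M f \<Longrightarrow> (\<integral>x. (A f x)\<^sup>2 \<partial>M) \<le> (\<integral>x. A f x * f x \<partial>M)"
begin

lemma cong:
  assumes "square_integrable M f" "square_integrable M g" "AE x in M. f x = g x"
  shows "AE x in M. A f x = A g x"
proof -
  have "AE x in M. f x \<le> g x" "AE x in M. g x \<le> f x" using assms(3) by auto
  from mono[OF assms(1,2) this(1)] mono[OF assms(2,1) this(2)]
  show ?thesis by eventually_elim simp
qed

lemma diff:
  assumes "square_integrable M f" "square_integrable M g"
  shows "AE x in M. A (\<lambda>x. f x - g x) x = A f x - A g x"
  using lin[OF assms, of "-1"] by simp

lemma zero: "AE x in M. A (\<lambda>_. 0) x = 0"
  using diff[OF square_integrable_zero square_integrable_zero] by simp

lemma const_diff: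
  assumes "square_integrable M f"
  shows "AE x in M. A (\<lambda>x. f x - c) x = A f x - c"
  using lin[OF assms square_integrable_const[of 1], of "-c"] one
  by eventually_elim simp

lemma sum:
  assumes "\<And>k. square_integrable M (h k)"
  shows "AE x in M. A (\<lambda>x. \<Sum>k<(n::nat). h k x) x = (\<Sum>k<n. A (h k) x)"
proof (induction n)
  case 0
  then show ?case using zero by simp
next
  case (Suc n)
  from lin[OF square_integrable_sum[where h = h and n = n, OF assms] assms[of n], of 1] Suc
  show ?case by eventually_elim simp
qed

lemma abs_le:
  assumes "square_integrable M f"
  shows "AE x in M. \<bar>A f x\<bar> \<le> A (\<lambda>x. \<bar>f x\<bar>) x"
proof -
  note a = square_integrable_abs[OF assms]
  have "AE x in M. A f x \<le> A (\<lambda>x. \<bar>f x\<bar>) x"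
    by (rule mono[OF assms a]) simp
  moreover have "AE x in M. A (\<lambda>x. 0 - f x) x \<le> A (\<lambda>x. \<bar>f x\<bar>) x"
    by (rule mono[OF square_integrable_diff[OF square_integrable_zero assms] a]) simp
  moreover note diff[OF square_integrable_zero assms] zero
  ultimately show ?thesis by eventually_elim simp
qed

lemma integral_eq:
  assumes "square_integrable M f"
  shows "(\<integral>x. A f x \<partial>M) = (\<integral>x. f x \<partial>M)"
proof -
  have "(\<integral>x. A f x \<partial>M) = (\<integral>x. f x * A (\<lambda>_. 1) x \<partial>M)"
    using sym[OF assms square_integrable_const[of 1]] by simp
  also have "\<dots> = (\<integral>x. f x \<partial>M)"
    by (rule integral_cong_AE)
      (use one square_integrable_measurable[OF assms]
         square_integrable_measurable[OF sq[OF square_integrable_const[of 1]]] in auto)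
  finally show ?thesis .
qed

lemma contraction:
  assumes "square_integrable M f"
  shows "(\<integral>x. A f x * f x \<partial>M) \<le> (\<integral>x. (f x)\<^sup>2 \<partial>M)"
    and "(\<integral>x. (A f x)\<^sup>2 \<partial>M) \<le> (\<integral>x. (f x)\<^sup>2 \<partial>M)"
proof -
  note 1 = firm[OF assms]
  have "0 \<le> (\<integral>x. (A f x - f x)\<^sup>2 \<partial>M)" by simp
  then have "2 * (\<integral>x. A f x * f x \<partial>M) \<le> (\<integral>x. (A f x)\<^sup>2 \<partial>M) + (\<integral>x. (f x)\<^sup>2 \<partial>M)"
    unfolding integral_square_diff[OF sq[OF assms] assms] by linarith
  with 1 show "(\<integral>x. A f x * f x \<partial>M) \<le> (\<integral>x. (f x)\<^sup>2 \<partial>M)"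
    "(\<integral>x. (A f x)\<^sup>2 \<partial>M) \<le> (\<integral>x. (f x)\<^sup>2 \<partial>M)" by linarith+
qed

lemma pow_sq: "square_integrable M f \<Longrightarrow> square_integrable M ((A ^^ n) f)"
  by (induction n) (simp_all add: sq)

lemma pow_diff:
  assumes "square_integrable M f" "square_integrable M g"
  shows "AE x in M. (A ^^ n) (\<lambda>x. f x - g x) x = (A ^^ n) f x - (A ^^ n) g x"
proof (induction n)
  case (Suc n)
  note s = pow_sq[OF assms(1), of n] pow_sq[OF assms(2), of n]
  from cong[OF pow_sq[OF square_integrable_diff[OF assms]] square_integrable_diff[OF s] Suc] diff[OF s]
  show ?case by eventually_elim simp
qed simp

lemma pow_sym:
  assumes "square_integrable M f" "square_integrable M g"
  shows "(\<integral>x. (A ^^ n) f x * g x \<partial>M) = (\<integral>x. f x * (A ^^ n) g x \<partial>M)"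
  using assms(2)
proof (induction n arbitrary: g)
  case (Suc n)
  have "(\<integral>x. (A ^^ Suc n) f x * g x \<partial>M) = (\<integral>x. (A ^^ n) f x * A g x \<partial>M)"
    using sym[OF pow_sq[OF assms(1)] Suc.prems] by simp
  also have "\<dots> = (\<integral>x. f x * (A ^^ Suc n) g x \<partial>M)"
    using Suc.IH[OF sq[OF Suc.prems]] by (simp add: funpow_swap1)
  finally show ?case .
qed simp

text \<open>The moment sequence \<open>\<langle>A ^ n f, f\<rangle>\<close>. It is completely monotone; only the signs of its
  differences up to order three are needed, and these are obtained without the spectral theorem.\<close>
definition moment :: "nat \<Rightarrow> ('a \<Rightarrow> real) \<Rightarrow> real" where
  "moment n f = (\<integral>x. (A ^^ n) f x * f x \<partial>M)"

lemma pow_inner: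
  assumes "square_integrable M f"
  shows "(\<integral>x. (A ^^ m) f x * (A ^^ n) f x \<partial>M) = moment (m + n) f"
  using pow_sym[OF pow_sq[OF assms] assms, of n m]
  by (simp add: moment_def funpow_add add.commute[of m n])

lemma pow_norm:
  "square_integrable M f \<Longrightarrow> (\<integral>x. ((A ^^ n) f x)\<^sup>2 \<partial>M) = moment (2 * n) f"
  using pow_inner[of f n n] by (simp add: power2_eq_square mult_2)

lemma moment_antimono_step:
  assumes "square_integrable M f"
  shows "moment (Suc n) f \<le> moment n f"
proof (cases "even n")
  case True
  then obtain m where m: "n = 2 * m" by (elim evenE)
  \<comment> \<open>with \<open>h = A ^ m f\<close> this is \<open>\<langle>A h, h\<rangle> \<le> \<parallel>h\<parallel>\<^sup>2\<close>\<close>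
  show ?thesis
    using contraction(1)[OF pow_sq[OF assms, of m]] pow_inner[OF assms, of "Suc m" m] pow_norm[OF assms, of m]
    by (simp add: m mult_2)
next
  case False
  then obtain m where m: "n = 2 * m + 1" by (elim oddE)
  \<comment> \<open>with \<open>h = A ^ m f\<close> this is \<open>\<parallel>A h\<parallel>\<^sup>2 \<le> \<langle>A h, h\<rangle>\<close>\<close>
  show ?thesis
    using firm[OF pow_sq[OF assms, of m]] pow_inner[OF assms, of "Suc m" m] pow_norm[OF assms, of "Suc m"]
    by (simp add: m mult_2)
qed

lemma moment_antimono:
  assumes "square_integrable M f" "m \<le> n"
  shows "moment n f \<le> moment m f"
  using assms(2) by (rule lift_Suc_antimono_le[of "\<lambda>n. moment n f", OF moment_antimono_step[OF assms(1)]])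

lemma moment_nonneg:
  assumes "square_integrable M f"
  shows "0 \<le> moment n f"
proof -
  have "0 \<le> (\<integral>x. ((A ^^ n) f x)\<^sup>2 \<partial>M)" by simp
  also have "\<dots> = moment (2 * n) f" by (rule pow_norm[OF assms])
  also have "\<dots> \<le> moment n f" by (rule moment_antimono[OF assms]) simp
  finally show ?thesis .
qed

lemma pow_increment:
  assumes "square_integrable M f"
  shows "AE x in M. (A ^^ n) (\<lambda>x. f x - A f x) x = (A ^^ n) f x - (A ^^ Suc n) f x"
  using pow_diff[OF assms sq[OF assms], of n] by (simp add: funpow_swap1)

text \<open>The moments of \<open>f - A f\<close> are the second differences of the moments of \<open>f\<close>.\<close>
lemma moment_increment:
  assumes "square_integrable M f"
  shows "moment n (\<lambda>x. f x - A f x) = moment n f - 2 * moment (Suc n) f + moment (Suc (Suc n)) f"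
proof -
  note s = pow_sq[OF assms, of n] pow_sq[OF assms, of "Suc n"] sq[OF assms]
    pow_sq[OF square_integrable_diff[OF assms sq[OF assms]], of n]
  note [measurable] = s[THEN square_integrable_measurable] square_integrable_measurable[OF assms]
  note i = square_integrable_mult[OF s(1) assms] square_integrable_mult[OF s(1,3)]
    square_integrable_mult[OF s(2) assms] square_integrable_mult[OF s(2,3)]
  have "moment n (\<lambda>x. f x - A f x)
      = (\<integral>x. ((A ^^ n) f x - (A ^^ Suc n) f x) * (f x - A f x) \<partial>M)"
    unfolding moment_def
    by (rule integral_cong_AE) (measurable, use pow_increment[OF assms, of n] in auto)
  also have "\<dots> = (\<integral>x. (A ^^ n) f x * f x - (A ^^ n) f x * A f x
      - ((A ^^ Suc n) f x * f x - (A ^^ Suc n) f x * A f x) \<partial>M)"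
    by (simp add: algebra_simps)
  also have "\<dots> = moment n f - moment (Suc n) f - (moment (Suc n) f - moment (Suc (Suc n)) f)"
    using i pow_inner[OF assms, of n 0] pow_inner[OF assms, of n 1]
      pow_inner[OF assms, of "Suc n" 0] pow_inner[OF assms, of "Suc n" 1]
    by (simp del: funpow.simps(2) add: funpow_0 funpow.simps(2)[of 0])
  finally show ?thesis by simp
qed

text \<open>The bound for the square function. The weight \<open>k + 1\<close> is absorbed by a summation by parts:
  with \<open>b k\<close> the first differences of the moments, \<open>\<Sum>k<N. (k + 1) * (b k - b (k + 1))\<close> is
  at most \<open>\<Sum>k<N. b k\<close>, which telescopes.\<close>
lemma increment_square_sum:
  assumes "square_integrable M f"
  shows "(\<Sum>k<N. (real k + 1) * (\<integral>x. ((A ^^ k) (\<lambda>x. f x - A f x) x)\<^sup>2 \<partial>M)) \<le> (\<integral>x. (f x)\<^sup>2 \<partial>M)"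
proof -
  define d where "d = (\<lambda>x. f x - A f x)"
  have d: "square_integrable M d" unfolding d_def by (rule square_integrable_diff[OF assms sq[OF assms]])
  define b where "b n = moment n f - moment (Suc n) f" for n
  have b: "b n \<ge> 0" for n using moment_antimono_step[OF assms] by (simp add: b_def)
  have "(\<Sum>k<N. (real k + 1) * (\<integral>x. ((A ^^ k) d x)\<^sup>2 \<partial>M)) \<le> (\<Sum>k<N. (real k + 1) * (b k - b (Suc k)))"
  proof (intro sum_mono mult_left_mono)
    fix k
    have "(\<integral>x. ((A ^^ k) d x)\<^sup>2 \<partial>M) \<le> moment k d"
      unfolding pow_norm[OF d] by (rule moment_antimono[OF d]) simp
    also have "\<dots> = b k - b (Suc k)"
      unfolding d_def moment_increment[OF assms] by (simp add: b_def)
    finally show "(\<integral>x. ((A ^^ k) d x)\<^sup>2 \<partial>M) \<le> b k - b (Suc k)" .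
  qed simp
  also have "\<dots> = (\<Sum>k<N. b k) - real N * b N"
    by (induction N) (simp_all add: algebra_simps)
  also have "\<dots> \<le> (\<Sum>k<N. b k)" using b by simp
  also have "\<dots> = moment 0 f - moment N f"
    unfolding b_def by (rule sum_lessThan_telescope')
  also have "\<dots> \<le> (\<integral>x. (f x)\<^sup>2 \<partial>M)"
    using moment_nonneg[OF assms, of N] by (simp add: moment_def power2_eq_square)
  finally show ?thesis unfolding d_def .
qed

section \<open>The maximal inequality\<close>

text \<open>An almost everywhere majorant of the partial sums \<open>v + A v + ... + A ^ (m - 1) v\<close> with
  \<open>m \<le> n\<close>. In place of their pointwise maximum, the truncated sums are generated recursively; this keeps the estimate
  \<open>hopf v n \<le> v + A (hopf v n)\<close> on the set where \<open>hopf v n\<close> is positive, on which the maximal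
  ergodic theorem rests.\<close>
primrec hopf :: "('a \<Rightarrow> real) \<Rightarrow> nat \<Rightarrow> 'a \<Rightarrow> real" where
  "hopf v 0 = (\<lambda>x. 0)"
| "hopf v (Suc n) = (\<lambda>x. max 0 (v x + A (hopf v n) x))"

lemma hopf_sq: "square_integrable M v \<Longrightarrow> square_integrable M (hopf v n)"
  by (induction n)
    (simp_all add: square_integrable_zero square_integrable_max square_integrable_add sq)

lemma hopf_nonneg: "0 \<le> hopf v n x"
  by (cases n) simp_all

lemma hopf_mono_step:
  assumes "square_integrable M v"
  shows "AE x in M. hopf v n x \<le> hopf v (Suc n) x"
proof (induction n)
  case (Suc n)
  from mono[OF hopf_sq[OF assms] hopf_sq[OF assms] Suc] show ?case
    by eventually_elim (simp add: max_def)
qed simp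

lemma hopf_mono:
  assumes "square_integrable M v"
  shows "AE x in M. \<forall>m n. m \<le> n \<longrightarrow> hopf v m x \<le> hopf v n x"
proof -
  have "AE x in M. \<forall>n. hopf v n x \<le> hopf v (Suc n) x"
    unfolding AE_all_countable using hopf_mono_step[OF assms] by blast
  then show ?thesis
  proof eventually_elim
    case (elim x)
    then have "hopf v m x \<le> hopf v n x" if "m \<le> n" for m n
      using that by (intro lift_Suc_mono_le[of "\<lambda>n. hopf v n x" m n]) blast+
    then show ?case by blast
  qed
qed

text \<open>The maximal ergodic theorem of Hopf, by Garsia's argument: \<open>hopf v n - A (hopf v n)\<close> has
  integral \<open>0\<close>, is at most \<open>v\<close> where \<open>hopf v n > 0\<close>, and is at most \<open>0\<close> elsewhere.\<close>
lemma maximal_ergodic: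
  assumes v: "square_integrable M v"
  shows "0 \<le> (\<integral>x. v x * indicator {x \<in> space M. 0 < hopf v n x} x \<partial>M)"
proof -
  note s = hopf_sq[OF v, of n]
  note [measurable] = s[THEN square_integrable_measurable] v[THEN square_integrable_measurable]
  have pos: "AE x in M. 0 \<le> A (hopf v n) x"
    using mono[OF square_integrable_zero s] zero hopf_nonneg by fastforce
  have "AE x in M. hopf v n x - A (hopf v n) x \<le> v x * indicator {x \<in> space M. 0 < hopf v n x} x"
  proof (cases n)
    case 0
    show ?thesis using pos unfolding 0 by eventually_elim simp
  next
    case (Suc m)
    have "AE x in M. A (hopf v m) x \<le> A (hopf v n) x"
      unfolding Suc by (rule mono[OF hopf_sq[OF v] hopf_sq[OF v] hopf_mono_step[OF v]])
    with pos AE_space show ?thesis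
      unfolding Suc by eventually_elim (simp add: indicator_def max_def)
  qed
  then have "(\<integral>x. hopf v n x - A (hopf v n) x \<partial>M)
      \<le> (\<integral>x. v x * indicator {x \<in> space M. 0 < hopf v n x} x \<partial>M)"
    using square_integrable_imp_integrable[OF v] square_integrable_imp_integrable[OF s]
      square_integrable_imp_integrable[OF sq[OF s]]
    by (intro integral_mono_AE Bochner_Integration.integrable_diff integrable_real_mult_indicator) auto
  moreover have "(\<integral>x. hopf v n x - A (hopf v n) x \<partial>M) = 0"
    using integral_eq[OF s] square_integrable_imp_integrable[OF s]
      square_integrable_imp_integrable[OF sq[OF s]] by simp
  ultimately show ?thesis by simp
qed

text \<open>For \<open>v = \<bar>u\<bar> - c\<close> the set where \<open>hopf v n\<close> is positive contains, up to a null set, the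
  points at which the average of \<open>\<bar>u\<bar>, \<bar>A u\<bar>, ..., \<bar>A ^ (n - 1) u\<bar>\<close> exceeds \<open>c\<close>.\<close>
lemma orbit_sum_le_hopf:
  assumes u: "square_integrable M u"
  shows "AE x in M. (\<Sum>k<n. \<bar>(A ^^ k) u x\<bar>) - real n * c \<le> hopf (\<lambda>x. \<bar>u x\<bar> - c) n x"
proof (induction n)
  case (Suc n)
  define v where "v = (\<lambda>x. \<bar>u x\<bar> - c)"
  define D where "D = (\<lambda>x. \<Sum>k<n. \<bar>(A ^^ k) u x\<bar>)"
  have v: "square_integrable M v"
    unfolding v_def by (intro square_integrable_diff square_integrable_abs u square_integrable_const)
  have a: "square_integrable M (\<lambda>x. \<bar>(A ^^ k) u x\<bar>)" for k
    by (intro square_integrable_abs pow_sq u)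
  have D: "square_integrable M D"
    unfolding D_def by (rule square_integrable_sum[OF a])
  have "AE x in M. \<forall>k. \<bar>(A ^^ Suc k) u x\<bar> \<le> A (\<lambda>x. \<bar>(A ^^ k) u x\<bar>) x"
    unfolding AE_all_countable using abs_le[OF pow_sq[OF u]] by simp
  moreover have "AE x in M. A D x = (\<Sum>k<n. A (\<lambda>x. \<bar>(A ^^ k) u x\<bar>) x)"
    unfolding D_def by (rule sum[OF a])
  moreover note const_diff[OF D, of "real n * c"]
  moreover have "AE x in M. A (\<lambda>x. D x - real n * c) x \<le> A (hopf v n) x"
    using Suc by (intro mono square_integrable_diff D square_integrable_const hopf_sq v) (simp add: D_def v_def)
  ultimately have "AE x in M. (\<Sum>k<Suc n. \<bar>(A ^^ k) u x\<bar>) - real (Suc n) * c \<le> hopf v (Suc n) x"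
  proof eventually_elim
    case (elim x)
    have "(\<Sum>k<n. \<bar>(A ^^ Suc k) u x\<bar>) \<le> (\<Sum>k<n. A (\<lambda>x. \<bar>(A ^^ k) u x\<bar>) x)"
      using elim(1) by (intro sum_mono) blast
    also have "\<dots> \<le> A (hopf v n) x + real n * c" using elim by linarith
    finally have "\<bar>u x\<bar> + (\<Sum>k<n. \<bar>(A ^^ Suc k) u x\<bar>) - real (Suc n) * c \<le> v x + A (hopf v n) x"
      by (simp add: v_def algebra_simps)
    then show ?case by (subst sum.lessThan_Suc_shift) simp
  qed
  then show ?case unfolding v_def .
qed simp

lemma ergodic_maximal_inequality:
  assumes u: "square_integrable M u" and "c > 0"
  shows "prob {x \<in> space M. \<exists>n. (\<Sum>k<n. \<bar>(A ^^ k) u x\<bar>) > real n * c} \<le> (\<integral>x. \<bar>u x\<bar> \<partial>M) / c"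
proof -
  have [measurable]: "(A ^^ k) u \<in> borel_measurable M" for k
    by (rule square_integrable_measurable[OF pow_sq[OF u]])
  note [measurable] = u[THEN square_integrable_measurable]
  define v where "v = (\<lambda>x. \<bar>u x\<bar> - c)"
  have v: "square_integrable M v"
    unfolding v_def by (intro square_integrable_diff square_integrable_abs u square_integrable_const)
  have [measurable]: "hopf v n \<in> borel_measurable M" for n
    by (rule square_integrable_measurable[OF hopf_sq[OF v]])
  define E where "E N = {x \<in> space M. \<exists>n\<le>N. (\<Sum>k<n. \<bar>(A ^^ k) u x\<bar>) > real n * c}" for N
  have "prob (\<Union>N. E N) \<le> (\<integral>x. \<bar>u x\<bar> \<partial>M) / c"
  proof (rule prob_Union_incseq_le)
    show "range E \<subseteq> events" unfolding E_def by auto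
    show "incseq E" unfolding E_def incseq_def by (auto intro: order_trans)
    fix N
    define P where "P = {x \<in> space M. 0 < hopf v N x}"
    have [measurable]: "P \<in> events" unfolding P_def by measurable
    have "AE x in M. \<forall>n. (\<Sum>k<n. \<bar>(A ^^ k) u x\<bar>) - real n * c \<le> hopf v n x"
      unfolding AE_all_countable v_def using orbit_sum_le_hopf[OF u] by blast
    with hopf_mono[OF v] have "AE x in M. x \<in> E N \<longrightarrow> x \<in> P"
    proof eventually_elim
      case (elim x)
      show ?case
      proof
        assume "x \<in> E N"
        then obtain n where n: "x \<in> space M" "n \<le> N" "(\<Sum>k<n. \<bar>(A ^^ k) u x\<bar>) > real n * c"
          unfolding E_def by auto
        have "0 < (\<Sum>k<n. \<bar>(A ^^ k) u x\<bar>) - real n * c" using n by simp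
        also have "\<dots> \<le> hopf v n x" using elim by blast
        also have "\<dots> \<le> hopf v N x" using elim n by blast
        finally show "x \<in> P" using n by (simp add: P_def)
      qed
    qed
    then have "prob (E N) \<le> prob P" by (intro finite_measure_mono_AE) auto
    also have "\<dots> \<le> (\<integral>x. \<bar>u x\<bar> \<partial>M) / c"
    proof -
      have i: "integrable M (\<lambda>x. \<bar>u x\<bar> * indicator P x)"
        using square_integrable_imp_integrable[OF square_integrable_abs[OF u]]
        by (intro integrable_real_mult_indicator) auto
      have "0 \<le> (\<integral>x. \<bar>u x\<bar> * indicator P x - c * indicator P x \<partial>M)"
        using maximal_ergodic[OF v, of N] unfolding P_def[symmetric] by (simp add: v_def left_diff_distrib)
      also have "\<dots> = (\<integral>x. \<bar>u x\<bar> * indicator P x \<partial>M) - c * prob P"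
        using i by (subst Bochner_Integration.integral_diff) (auto simp: emeasure_eq_measure)
      also have "(\<integral>x. \<bar>u x\<bar> * indicator P x \<partial>M) \<le> (\<integral>x. \<bar>u x\<bar> \<partial>M)"
        using i square_integrable_imp_integrable[OF square_integrable_abs[OF u]]
        by (intro integral_mono) (auto simp: indicator_def)
      finally show ?thesis using \<open>c > 0\<close> by (simp add: field_simps)
    qed
    finally show "prob (E N) \<le> (\<integral>x. \<bar>u x\<bar> \<partial>M) / c" .
  qed
  moreover have "(\<Union>N. E N) = {x \<in> space M. \<exists>n. (\<Sum>k<n. \<bar>(A ^^ k) u x\<bar>) > real n * c}"
    unfolding E_def by auto
  ultimately show ?thesis by simp
qed

lemma square_function_inequality:
  assumes u: "square_integrable M u" and "c > 0"
  shows "prob {x \<in> space M. \<exists>N. (\<Sum>k<N. (real k + 1) * ((A ^^ k) u x - (A ^^ Suc k) u x)\<^sup>2) > c}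
    \<le> (\<integral>x. (u x)\<^sup>2 \<partial>M) / c"
proof -
  note s = pow_sq[OF u]
  have [measurable]: "(A ^^ k) u \<in> borel_measurable M" for k
    by (rule square_integrable_measurable[OF s])
  define Q where "Q N x = (\<Sum>k<N. (real k + 1) * ((A ^^ k) u x - (A ^^ Suc k) u x)\<^sup>2)" for N x
  have [measurable]: "Q N \<in> borel_measurable M" for N
    unfolding Q_def by (simp del: funpow.simps)
  define E where "E N = {x \<in> space M. Q N x > c}" for N
  have "prob (\<Union>N. E N) \<le> (\<integral>x. (u x)\<^sup>2 \<partial>M) / c"
  proof (rule prob_Union_incseq_le)
    show "range E \<subseteq> events" unfolding E_def by auto
    have "Q N x \<le> Q (Suc N) x" for N x unfolding Q_def by simp
    then have "E N \<subseteq> E (Suc N)" for N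
      unfolding E_def by (auto intro: order_less_le_trans)
    then show "incseq E" by (rule incseq_SucI)
    fix N
    have i: "integrable M (\<lambda>x. (real k + 1) * ((A ^^ k) u x - (A ^^ Suc k) u x)\<^sup>2)" for k
      by (intro integrable_mult_right square_integrable_power2 square_integrable_diff s)
    have "prob (E N) \<le> prob {x \<in> space M. Q N x \<ge> c}"
      unfolding E_def by (intro finite_measure_mono) auto
    also have "\<dots> \<le> (\<integral>x. Q N x \<partial>M) / c"
    proof (rule integral_Markov_inequality_measure[where A = "{}"])
      show "integrable M (Q N)"
        unfolding Q_def by (rule Bochner_Integration.integrable_sum) (rule i)
      show "AE x in M. 0 \<le> Q N x" unfolding Q_def by (intro AE_I2 sum_nonneg) simp
    qed (use \<open>c > 0\<close> in auto)
    also have "(\<integral>x. Q N x \<partial>M) = (\<Sum>k<N. (real k + 1) * (\<integral>x. ((A ^^ k) u x - (A ^^ Suc k) u x)\<^sup>2 \<partial>M))"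
      unfolding Q_def by (subst Bochner_Integration.integral_sum[OF i]) (simp del: funpow.simps)
    also have "\<dots> = (\<Sum>k<N. (real k + 1) * (\<integral>x. ((A ^^ k) (\<lambda>x. u x - A u x) x)\<^sup>2 \<partial>M))"
    proof (intro sum.cong refl arg_cong2[where f = "(*)"] integral_cong_AE)
      fix k
      have [measurable]: "(A ^^ k) (\<lambda>x. u x - A u x) \<in> borel_measurable M"
        by (intro square_integrable_measurable pow_sq square_integrable_diff u sq)
      show "(\<lambda>x. ((A ^^ k) (\<lambda>x. u x - A u x) x)\<^sup>2) \<in> borel_measurable M" by measurable
      show "(\<lambda>x. ((A ^^ k) u x - (A ^^ Suc k) u x)\<^sup>2) \<in> borel_measurable M"
        by (simp del: funpow.simps)
      show "AE x in M. ((A ^^ k) u x - (A ^^ Suc k) u x)\<^sup>2 = ((A ^^ k) (\<lambda>x. u x - A u x) x)\<^sup>2"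
        using pow_increment[OF u, of k] by eventually_elim (simp del: funpow.simps)
    qed
    also have "\<dots> \<le> (\<integral>x. (u x)\<^sup>2 \<partial>M)" by (rule increment_square_sum[OF u])
    finally show "prob (E N) \<le> (\<integral>x. (u x)\<^sup>2 \<partial>M) / c"
      using \<open>c > 0\<close> by (simp add: divide_right_mono)
  qed
  moreover have "(\<Union>N. E N) = {x \<in> space M. \<exists>N. Q N x > c}"
    unfolding E_def by auto
  ultimately show ?thesis unfolding Q_def by simp
qed

text \<open>By summation by parts, \<open>(n + 1) * w n\<close> differs from \<open>w 0 + ... + w n\<close> by
  \<open>\<Sum>k<n. (k + 1) * (w k - w (k + 1))\<close>, which the Cauchy--Schwarz inequality for the weights
  \<open>k + 1\<close> estimates by the square function.\<close>
lemma (in -) average_comparison: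
  fixes w :: "nat \<Rightarrow> real"
  assumes avg: "(\<Sum>k<Suc n. \<bar>w k\<bar>) \<le> real (Suc n) * c"
    and sqf: "(\<Sum>k<n. (real k + 1) * (w k - w (Suc k))\<^sup>2) \<le> c\<^sup>2" and "c \<ge> 0"
  shows "\<bar>w n\<bar> \<le> 2 * c"
proof -
  define R where "R = (\<Sum>k<n. (real k + 1) * (w k - w (Suc k)))"
  have eq: "real (Suc n) * w n = (\<Sum>k<Suc n. w k) - R" unfolding R_def
    by (induction n) (simp_all add: algebra_simps)
  have "R\<^sup>2 = (\<Sum>k<n. sqrt (real k + 1) * (sqrt (real k + 1) * (w k - w (Suc k))))\<^sup>2"
    unfolding R_def by (simp add: mult.assoc[symmetric])
  also have "\<dots> \<le> (\<Sum>k<n. (sqrt (real k + 1))\<^sup>2) * (\<Sum>k<n. (sqrt (real k + 1) * (w k - w (Suc k)))\<^sup>2)"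
    by (rule Cauchy_Schwarz_ineq_sum)
  also have "\<dots> = (\<Sum>k<n. real k + 1) * (\<Sum>k<n. (real k + 1) * (w k - w (Suc k))\<^sup>2)"
    by (simp add: power_mult_distrib)
  also have "\<dots> \<le> (real (Suc n))\<^sup>2 * c\<^sup>2"
  proof (rule mult_mono[OF _ sqf])
    show "(\<Sum>k<n. real k + 1) \<le> (real (Suc n))\<^sup>2"
      by (induction n) (simp_all add: power2_eq_square algebra_simps)
  qed (auto intro!: sum_nonneg)
  finally have "\<bar>R\<bar>\<^sup>2 \<le> (real (Suc n) * c)\<^sup>2"
    by (simp only: power2_abs power_mult_distrib)
  then have "\<bar>R\<bar> \<le> real (Suc n) * c"
    by (rule power2_le_imp_le) (use \<open>c \<ge> 0\<close> in simp)
  moreover have "\<bar>\<Sum>k<Suc n. w k\<bar> \<le> real (Suc n) * c"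
    using sum_abs[of w "{..<Suc n}"] avg by linarith
  ultimately have "\<bar>real (Suc n) * w n\<bar> \<le> real (Suc n) * (2 * c)"
    unfolding eq by (simp add: algebra_simps)
  then show ?thesis by (simp add: abs_mult del: of_nat_Suc)
qed

text \<open>If \<open>\<bar>(A ^^ n) u\<bar>\<close> exceeds \<open>2 * c\<close>, then an average of the \<open>\<bar>(A ^^ k) u\<bar>\<close> exceeds \<open>c\<close> or the square
  function exceeds \<open>c\<^sup>2\<close>. The supremum over all \<open>n\<close> is thus controlled by \<open>\<parallel>u\<parallel>\<close> alone.\<close>
lemma maximal_inequality:
  assumes u: "square_integrable M u" and "c > 0"
  shows "prob {x \<in> space M. \<exists>n. \<bar>(A ^^ n) u x\<bar> > 2 * c}
    \<le> sqrt (\<integral>x. (u x)\<^sup>2 \<partial>M) / c + (\<integral>x. (u x)\<^sup>2 \<partial>M) / c\<^sup>2"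
proof -
  have [measurable]: "(A ^^ k) u \<in> borel_measurable M" for k
    by (rule square_integrable_measurable[OF pow_sq[OF u]])
  let ?P = "{x \<in> space M. \<exists>n. (\<Sum>k<n. \<bar>(A ^^ k) u x\<bar>) > real n * c}"
  let ?Q = "{x \<in> space M. \<exists>N. (\<Sum>k<N. (real k + 1) * ((A ^^ k) u x - (A ^^ Suc k) u x)\<^sup>2) > c\<^sup>2}"
  have meas: "?P \<in> events" "?Q \<in> events" by (simp_all del: funpow.simps)
  have "{x \<in> space M. \<exists>n. \<bar>(A ^^ n) u x\<bar> > 2 * c} \<subseteq> ?P \<union> ?Q"
  proof
    fix x assume "x \<in> {x \<in> space M. \<exists>n. \<bar>(A ^^ n) u x\<bar> > 2 * c}"
    then obtain n where n: "x \<in> space M" "\<bar>(A ^^ n) u x\<bar> > 2 * c" by blast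
    show "x \<in> ?P \<union> ?Q"
    proof (rule ccontr)
      assume "x \<notin> ?P \<union> ?Q"
      then have "(\<Sum>k<Suc n. \<bar>(A ^^ k) u x\<bar>) \<le> real (Suc n) * c"
        "(\<Sum>k<n. (real k + 1) * ((A ^^ k) u x - (A ^^ Suc k) u x)\<^sup>2) \<le> c\<^sup>2"
        using n(1) unfolding Un_iff mem_Collect_eq de_Morgan_disj de_Morgan_conj not_ex not_less by blast+
      then have "\<bar>(A ^^ n) u x\<bar> \<le> 2 * c"
        by (rule average_comparison) (use \<open>c > 0\<close> in simp)
      with n(2) show False by simp
    qed
  qed
  then have "prob {x \<in> space M. \<exists>n. \<bar>(A ^^ n) u x\<bar> > 2 * c} \<le> prob (?P \<union> ?Q)"
    using meas by (intro finite_measure_mono) auto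
  also have "\<dots> \<le> prob ?P + prob ?Q"
    using meas by (rule measure_Un_le)
  also have "\<dots> \<le> (\<integral>x. \<bar>u x\<bar> \<partial>M) / c + (\<integral>x. (u x)\<^sup>2 \<partial>M) / c\<^sup>2"
    using \<open>c > 0\<close> by (intro add_mono ergodic_maximal_inequality square_function_inequality u) auto
  also have "(\<integral>x. \<bar>u x\<bar> \<partial>M) / c \<le> sqrt (\<integral>x. (u x)\<^sup>2 \<partial>M) / c"
    using \<open>c > 0\<close> by (intro divide_right_mono integral_abs_le_L2 u) simp
  finally show ?thesis by simp
qed

section \<open>Convergence of the powers\<close>

lemma pow_L2_converges:
  assumes f: "square_integrable M f"
  obtains g where "square_integrable M g" "AE x in M. A g x = g x"
    "(\<lambda>n. \<integral>x. ((A ^^ n) f x - g x)\<^sup>2 \<partial>M) \<longlonglongrightarrow> 0"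
proof -
  have dist: "(\<integral>x. ((A ^^ m) f x - (A ^^ n) f x)\<^sup>2 \<partial>M)
      = moment (2 * m) f - 2 * moment (m + n) f + moment (2 * n) f" for m n
    by (simp add: integral_square_diff[OF pow_sq[OF f] pow_sq[OF f]] pow_norm[OF f] pow_inner[OF f])
  have "decseq (\<lambda>n. moment n f)"
    unfolding decseq_def using moment_antimono[OF f] by blast
  then obtain l where l: "(\<lambda>n. moment n f) \<longlonglongrightarrow> l" "\<And>n. l \<le> moment n f"
    using decseq_convergent[of "\<lambda>n. moment n f" 0] moment_nonneg[OF f] by blast
  have "\<exists>N. \<forall>m\<ge>N. \<forall>n\<ge>N. (\<integral>x. ((A ^^ m) f x - (A ^^ n) f x)\<^sup>2 \<partial>M) \<le> e" if "e > 0" for e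
  proof -
    obtain N where N: "\<And>n. n \<ge> N \<Longrightarrow> \<bar>moment n f - l\<bar> < e / 2"
      using LIMSEQ_D[OF l(1), of "e / 2"] \<open>e > 0\<close> by auto
    have "(\<integral>x. ((A ^^ m) f x - (A ^^ n) f x)\<^sup>2 \<partial>M) \<le> e" if "m \<ge> N" "n \<ge> N" for m n
      using N[of "2 * m"] N[of "2 * n"] l(2)[of "m + n"] that unfolding dist by linarith
    then show ?thesis by blast
  qed
  then obtain g where g: "square_integrable M g"
    and lim: "(\<lambda>n. \<integral>x. ((A ^^ n) f x - g x)\<^sup>2 \<partial>M) \<longlonglongrightarrow> 0"
    using L2_complete[of "\<lambda>n. (A ^^ n) f"] pow_sq[OF f] by blast
  let ?\<delta> = "\<lambda>n. \<integral>x. ((A ^^ n) f x - g x)\<^sup>2 \<partial>M"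
  note Ag = sq[OF g]
  note [measurable] = pow_sq[OF f, THEN square_integrable_measurable]
    Ag[THEN square_integrable_measurable]
  have "(\<integral>x. (A g x - g x)\<^sup>2 \<partial>M) \<le> 2 * ?\<delta> n + 2 * ?\<delta> (Suc n)" for n
  proof -
    note d = square_integrable_diff[OF pow_sq[OF f, of n] g]
    have "(\<integral>x. (A g x - (A ^^ Suc n) f x)\<^sup>2 \<partial>M) = (\<integral>x. (A (\<lambda>x. (A ^^ n) f x - g x) x)\<^sup>2 \<partial>M)"
    proof (rule integral_cong_AE)
      show "(\<lambda>x. (A (\<lambda>x. (A ^^ n) f x - g x) x)\<^sup>2) \<in> borel_measurable M"
        using sq[OF d, THEN square_integrable_measurable] by measurable
      show "AE x in M. (A g x - (A ^^ Suc n) f x)\<^sup>2 = (A (\<lambda>x. (A ^^ n) f x - g x) x)\<^sup>2"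
        using diff[OF pow_sq[OF f, of n] g] by eventually_elim (simp add: power2_commute)
    qed measurable
    also have "\<dots> \<le> ?\<delta> n" by (rule contraction(2)[OF d])
    finally show ?thesis
      using integral_square_triangle[OF square_integrable_diff[OF Ag pow_sq[OF f, of "Suc n"]]
          square_integrable_diff[OF pow_sq[OF f, of "Suc n"] g]]
      by simp
  qed
  moreover have "(\<lambda>n. 2 * ?\<delta> n + 2 * ?\<delta> (Suc n)) \<longlonglongrightarrow> 2 * 0 + 2 * 0"
    by (intro tendsto_intros lim LIMSEQ_Suc)
  ultimately have "(\<integral>x. (A g x - g x)\<^sup>2 \<partial>M) \<le> 0"
    by (intro LIMSEQ_le_const[of "\<lambda>n. 2 * ?\<delta> n + 2 * ?\<delta> (Suc n)"]) auto
  then have "AE x in M. A g x = g x"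
    using integral_square_zero[OF square_integrable_diff[OF Ag g]] by simp
  with g lim show ?thesis by (intro that)
qed

text \<open>The maximal inequality is applied to \<open>u = A ^ N f - g\<close>: as \<open>g\<close> is fixed, \<open>A ^ n u\<close> is the
  error \<open>A ^ (n + N) f - g\<close>, so the tail of the errors from index \<open>N\<close> on is uniformly small off
  a set whose probability tends to \<open>0\<close>.\<close>
lemma pow_AE_converges:
  assumes f: "square_integrable M f" and g: "square_integrable M g"
    and fixed: "AE x in M. A g x = g x"
    and lim: "(\<lambda>n. \<integral>x. ((A ^^ n) f x - g x)\<^sup>2 \<partial>M) \<longlonglongrightarrow> 0"
  shows "AE x in M. (\<lambda>n. (A ^^ n) f x) \<longlonglongrightarrow> g x"
proof -
  note [measurable] = pow_sq[OF f, THEN square_integrable_measurable]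
    g[THEN square_integrable_measurable]
  let ?\<delta> = "\<lambda>n. \<integral>x. ((A ^^ n) f x - g x)\<^sup>2 \<partial>M"
  have pow_g: "AE x in M. (A ^^ n) g x = g x" for n
  proof (induction n)
    case (Suc n)
    from cong[OF pow_sq[OF g] g Suc] fixed show ?case by eventually_elim simp
  qed simp
  define E where "E c = {x \<in> space M. \<forall>N. \<exists>n\<ge>N. \<bar>(A ^^ n) f x - g x\<bar> > 2 * c}" for c :: real
  have [measurable]: "E c \<in> events" for c unfolding E_def by measurable
  have null: "AE x in M. x \<notin> E c" if "c > 0" for c
  proof -
    have "prob (E c) \<le> sqrt (?\<delta> N) / c + ?\<delta> N / c\<^sup>2" for N
    proof -
      define u where "u = (\<lambda>x. (A ^^ N) f x - g x)"
      have u: "square_integrable M u"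
        unfolding u_def by (rule square_integrable_diff[OF pow_sq[OF f] g])
      note [measurable] = pow_sq[OF u, THEN square_integrable_measurable]
      have shift: "AE x in M. (A ^^ n) u x = (A ^^ (n + N)) f x - g x" for n
        using pow_diff[OF pow_sq[OF f, of N] g, of n] pow_g[of n] unfolding u_def
        by eventually_elim (simp add: funpow_add)
      have "AE x in M. \<forall>n. (A ^^ n) u x = (A ^^ (n + N)) f x - g x"
        unfolding AE_all_countable using shift by blast
      then have "AE x in M. x \<in> E c \<longrightarrow> x \<in> {x \<in> space M. \<exists>n. \<bar>(A ^^ n) u x\<bar> > 2 * c}"
      proof eventually_elim
        case (elim x)
        show ?case
        proof
          assume "x \<in> E c"
          then obtain n where n: "x \<in> space M" "n \<ge> N" "\<bar>(A ^^ n) f x - g x\<bar> > 2 * c"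
            unfolding E_def by blast
          then have "\<bar>(A ^^ (n - N)) u x\<bar> > 2 * c" using elim by simp
          with n show "x \<in> {x \<in> space M. \<exists>n. \<bar>(A ^^ n) u x\<bar> > 2 * c}" by blast
        qed
      qed
      then have "prob (E c) \<le> prob {x \<in> space M. \<exists>n. \<bar>(A ^^ n) u x\<bar> > 2 * c}"
        by (intro finite_measure_mono_AE) simp_all
      also have "\<dots> \<le> sqrt (?\<delta> N) / c + ?\<delta> N / c\<^sup>2"
        using maximal_inequality[OF u \<open>c > 0\<close>] unfolding u_def .
      finally show ?thesis .
    qed
    moreover have "(\<lambda>N. sqrt (?\<delta> N) / c + ?\<delta> N / c\<^sup>2) \<longlonglongrightarrow> sqrt 0 / c + 0 / c\<^sup>2"
      by (intro tendsto_add tendsto_divide tendsto_real_sqrt lim tendsto_const) (use \<open>c > 0\<close> in auto)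
    ultimately have "prob (E c) \<le> 0"
      by (intro LIMSEQ_le_const[of "\<lambda>N. sqrt (?\<delta> N) / c + ?\<delta> N / c\<^sup>2"]) auto
    then have "prob (E c) = 0" by (simp add: antisym)
    then show ?thesis by (subst (asm) prob_eq_0) simp_all
  qed
  have "AE x in M. \<forall>j. x \<notin> E (1 / real (Suc j))"
    unfolding AE_all_countable using null by simp
  then show ?thesis
    using AE_space
  proof eventually_elim
    case (elim x)
    show ?case
    proof (rule LIMSEQ_I)
      fix r :: real assume "r > 0"
      then obtain j where j: "1 / real (Suc j) < r / 2"
        using nat_approx_posE[of "r / 2"] by auto
      obtain N where "\<forall>n\<ge>N. \<bar>(A ^^ n) f x - g x\<bar> \<le> 2 * (1 / real (Suc j))"
        using elim unfolding E_def by (auto simp: not_less)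
      with j show "\<exists>N. \<forall>n\<ge>N. norm ((A ^^ n) f x - g x) < r"
        by (intro exI[of _ N]) force
    qed
  qed
qed

end

section \<open>Conditional expectations on \<open>L\<^sub>2\<close>\<close>

text \<open>A sub-\<open>\<sigma>\<close>-field \<open>F\<close> of a probability space. On square-integrable functions its conditional
  expectation \<open>CE\<close> is the orthogonal projection onto the \<open>F\<close>-measurable ones.\<close>
locale prob_subalgebra = prob_space M + finite_measure_subalgebra M F
  for M F :: "'a measure"
begin

abbreviation CE :: "('a \<Rightarrow> real) \<Rightarrow> 'a \<Rightarrow> real" where "CE \<equiv> real_cond_exp M F"

lemma CE_sq:
  assumes "square_integrable M f"
  shows "square_integrable M (CE f)"
proof -
  have "integrable M (\<lambda>x. (CE f x)\<^sup>2)"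
    by (rule integrable_convex_cond_exp[where I = UNIV])
      (use assms square_integrable_imp_integrable[OF assms] in
        \<open>auto simp: square_integrable_power2 convex_power2\<close>)
  then show ?thesis by (simp add: square_integrable_def)
qed

lemma CE_cong:
  assumes "square_integrable M f" "square_integrable M g" "AE x in M. f x = g x"
  shows "AE x in M. CE f x = CE g x"
  using real_cond_exp_cong[OF assms(3)] assms(1,2) by (simp add: square_integrable_def)

lemma CE_diff:
  assumes "square_integrable M f" "square_integrable M g"
  shows "AE x in M. CE (\<lambda>x. f x - g x) x = CE f x - CE g x"
  using assms by (intro real_cond_exp_diff square_integrable_imp_integrable)

lemma CE_lin:
  assumes "square_integrable M f" "square_integrable M g"
  shows "AE x in M. CE (\<lambda>x. f x + c * g x) x = CE f x + c * CE g x"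
proof -
  note i = assms[THEN square_integrable_imp_integrable]
  from real_cond_exp_add[OF i(1) integrable_mult_right[OF i(2), of c]] real_cond_exp_cmult[OF i(2), of c]
  show ?thesis by eventually_elim simp
qed

lemma CE_inner:
  assumes "square_integrable M f" "square_integrable M g"
  shows "(\<integral>x. CE f x * g x \<partial>M) = (\<integral>x. CE f x * CE g x \<partial>M)"
  using real_cond_exp_intg(2)[OF square_integrable_mult[OF CE_sq[OF assms(1)] assms(2)]
      borel_measurable_cond_exp square_integrable_measurable[OF assms(2)]] by simp

lemma CE_sym:
  assumes "square_integrable M f" "square_integrable M g"
  shows "(\<integral>x. CE f x * g x \<partial>M) = (\<integral>x. f x * CE g x \<partial>M)"
  using CE_inner[OF assms] CE_inner[OF assms(2,1)] by (simp add: mult.commute)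

text \<open>Pythagoras for the projection \<open>CE\<close>; in particular \<open>CE f = f\<close> almost everywhere as soon as
  \<open>CE\<close> preserves the norm of \<open>f\<close>.\<close>
lemma CE_residual:
  assumes "square_integrable M f"
  shows "(\<integral>x. (CE f x - f x)\<^sup>2 \<partial>M) = (\<integral>x. (f x)\<^sup>2 \<partial>M) - (\<integral>x. (CE f x)\<^sup>2 \<partial>M)"
  using integral_square_diff[OF CE_sq[OF assms] assms] CE_inner[OF assms assms]
  by (simp add: power2_eq_square)

lemma CE_contraction:
  assumes "square_integrable M f"
  shows "(\<integral>x. (CE f x)\<^sup>2 \<partial>M) \<le> (\<integral>x. (f x)\<^sup>2 \<partial>M)"
proof -
  have "0 \<le> (\<integral>x. (CE f x - f x)\<^sup>2 \<partial>M)" by simp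
  then show ?thesis unfolding CE_residual[OF assms] by simp
qed

lemma CE_idem:
  assumes "square_integrable M f"
  shows "AE x in M. CE (CE f) x = CE f x"
  using CE_sq[OF assms] by (intro real_cond_exp_F_meas square_integrable_imp_integrable) simp_all

lemma CE_L2_continuous:
  assumes "\<And>n. square_integrable M (s n)" "square_integrable M g"
    and "(\<lambda>n. \<integral>x. (s n x - g x)\<^sup>2 \<partial>M) \<longlonglongrightarrow> 0"
  shows "(\<lambda>n. \<integral>x. (CE (s n) x - CE g x)\<^sup>2 \<partial>M) \<longlonglongrightarrow> 0"
proof (rule tendsto_sandwich[OF _ _ tendsto_const assms(3)])
  have "(\<integral>x. (CE (s n) x - CE g x)\<^sup>2 \<partial>M) \<le> (\<integral>x. (s n x - g x)\<^sup>2 \<partial>M)" for n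
  proof -
    have "(\<integral>x. (CE (s n) x - CE g x)\<^sup>2 \<partial>M) = (\<integral>x. (CE (\<lambda>x. s n x - g x) x)\<^sup>2 \<partial>M)"
    proof (rule integral_cong_AE)
      show "AE x in M. (CE (s n) x - CE g x)\<^sup>2 = (CE (\<lambda>x. s n x - g x) x)\<^sup>2"
        using CE_diff[OF assms(1)[of n] assms(2)] by eventually_elim simp
    qed measurable
    then show ?thesis using CE_contraction[OF square_integrable_diff[OF assms(1)[of n] assms(2)]] by simp
  qed
  then show "\<forall>\<^sub>F n in sequentially. (\<integral>x. (CE (s n) x - CE g x)\<^sup>2 \<partial>M) \<le> (\<integral>x. (s n x - g x)\<^sup>2 \<partial>M)"
    by simp
qed simp

end

lemma prob_subalgebraI: "prob_space M \<Longrightarrow> subalgebra M F \<Longrightarrow> prob_subalgebra M F"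
  by (simp add: prob_subalgebra_def finite_measure_subalgebra_def
      finite_measure_subalgebra_axioms_def prob_space_def)

section \<open>Adjoining the null sets\<close>

lemma space_null_completion: "space (null_completion M G) = space M"
  by (simp add: null_completion_def space_measure_of_conv)

lemma sets_null_completion:
  assumes "subalgebra M G"
  shows "sets (null_completion M G) = sigma_sets (space M) (sets G \<union> null_sets M)"
proof -
  have "sets G \<union> null_sets M \<subseteq> Pow (space M)"
    using assms sets.space_closed[of M] unfolding subalgebra_def by auto
  then show ?thesis unfolding null_completion_def by simp
qed

lemma null_completion_AE_eq:
  assumes G: "subalgebra M G" and B: "B \<in> sets (null_completion M G)"
  shows "\<exists>C\<in>sets G. AE x in M. x \<in> B \<longleftrightarrow> x \<in> C"
  using B unfolding sets_null_completion[OF G]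
proof (induction rule: sigma_sets.induct)
  case (Basic a)
  then show ?case
  proof
    assume "a \<in> null_sets M"
    then show ?thesis by (intro bexI[of _ "{}"]) (auto simp: AE_not_in)
  qed auto
next
  case Empty
  then show ?case by (intro bexI[of _ "{}"]) auto
next
  case (Compl a)
  then obtain C where C: "C \<in> sets G" "AE x in M. x \<in> a \<longleftrightarrow> x \<in> C" by blast
  show ?case
  proof (rule bexI[of _ "space G - C"])
    show "AE x in M. x \<in> space M - a \<longleftrightarrow> x \<in> space G - C"
      using C(2) G unfolding subalgebra_def by auto
  qed (use C in auto)
next
  case (Union a)
  then obtain C where C: "\<And>i. C i \<in> sets G" "\<And>i. AE x in M. x \<in> a i \<longleftrightarrow> x \<in> C i" by metis
  have "AE x in M. \<forall>i. x \<in> a i \<longleftrightarrow> x \<in> C i"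
    unfolding AE_all_countable using C(2) by blast
  then have "AE x in M. x \<in> (\<Union>i. a i) \<longleftrightarrow> x \<in> (\<Union>i. C i)" by eventually_elim auto
  with C(1) show ?case by (intro bexI[of _ "\<Union>i. C i"]) auto
qed

lemma real_cond_exp_null_completion:
  assumes "prob_space M" "subalgebra M G" "square_integrable M f"
  shows "AE x in M. real_cond_exp M (null_completion M G) f x = real_cond_exp M G f x"
proof -
  interpret G: prob_subalgebra M G using assms by (intro prob_subalgebraI)
  interpret N: prob_subalgebra M "null_completion M G"
    using assms by (intro prob_subalgebraI subalgebra_null_completion)
  note i = G.square_integrable_imp_integrable[OF assms(3)]
    G.square_integrable_imp_integrable[OF G.CE_sq[OF assms(3)]]
  have "subalgebra (null_completion M G) G"
    using assms(2) unfolding subalgebra_def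
    by (auto simp: space_null_completion sets_null_completion[OF assms(2)])
  then have meas: "G.CE f \<in> borel_measurable (null_completion M G)"
    by (rule measurable_from_subalg) simp
  show ?thesis
  proof (rule N.real_cond_exp_charact[OF _ i meas])
    fix B assume B: "B \<in> sets (null_completion M G)"
    obtain C where C: "C \<in> sets G" "AE x in M. x \<in> B \<longleftrightarrow> x \<in> C"
      using null_completion_AE_eq[OF assms(2) B] by blast
    have [measurable]: "B \<in> sets M" "C \<in> sets M"
      using B C(1) N.subalg G.subalg unfolding subalgebra_def by auto
    have swap: "(\<integral>x\<in>B. h x \<partial>M) = (\<integral>x\<in>C. h x \<partial>M)" if [measurable]: "h \<in> borel_measurable M" for h :: "'a \<Rightarrow> real"
      unfolding set_lebesgue_integral_def
    proof (rule integral_cong_AE)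
      show "AE x in M. indicat_real B x *\<^sub>R h x = indicat_real C x *\<^sub>R h x"
        using C(2) by eventually_elim (simp add: indicator_def)
    qed measurable
    show "(\<integral>x\<in>B. f x \<partial>M) = (\<integral>x\<in>B. G.CE f x \<partial>M)"
      using swap[of f] swap[of "G.CE f"] G.real_cond_exp_intA[OF i(1) C(1)] i
      by (simp add: borel_measurable_integrable)
  qed
qed

text \<open>A field containing the null sets admits the modification of measurable functions on null sets.
  This is where the completion of the two fields is indispensable.\<close>
lemma measurable_AE_eq:
  fixes g h :: "'a \<Rightarrow> real"
  assumes F: "subalgebra M F" "null_sets M \<subseteq> sets F"
    and g: "g \<in> borel_measurable M" and h: "h \<in> borel_measurable F" and eq: "AE x in M. g x = h x"
  shows "g \<in> borel_measurable F"
proof (rule measurableI)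
  have sp: "space F = space M" using F(1) by (simp add: subalgebra_def)
  have hM: "h \<in> borel_measurable M" by (rule measurable_from_subalg[OF F(1) h])
  fix B :: "real set" assume B: "B \<in> sets borel"
  let ?G = "g -` B \<inter> space M" and ?H = "h -` B \<inter> space M"
  have meas: "?G \<in> sets M" "?H \<in> sets M"
    using measurable_sets[OF g B] measurable_sets[OF hM B] by auto
  have "AE x in M. x \<notin> ?G - ?H" "AE x in M. x \<notin> ?H - ?G"
    using eq by (eventually_elim, simp)+
  then have "?G - ?H \<in> null_sets M" "?H - ?G \<in> null_sets M"
    using meas by (simp_all add: AE_iff_null_sets)
  then have d: "?G - ?H \<in> sets F" "?H - ?G \<in> sets F" using F(2) by auto
  have H: "?H \<in> sets F" using measurable_sets[OF h B] sp by simp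
  have "(?H - (?H - ?G)) \<union> (?G - ?H) \<in> sets F" by (rule sets.Un[OF sets.Diff[OF H d(2)] d(1)])
  moreover have "(?H - (?H - ?G)) \<union> (?G - ?H) = ?G" by auto
  ultimately show "g -` B \<inter> space F \<in> sets F" using sp by simp
qed simp

section \<open>Alternating conditional expectations\<close>

text \<open>Two sub-\<open>\<sigma>\<close>-fields that contain all null sets of \<open>M\<close>; \<open>H\<close> is their intersection.\<close>
locale two_subalgebras = F1: prob_subalgebra M F1 + F2: prob_subalgebra M F2
  for M F1 F2 :: "'a measure" +
  assumes null1: "null_sets M \<subseteq> sets F1" and null2: "null_sets M \<subseteq> sets F2"
begin

abbreviation T1 :: "('a \<Rightarrow> real) \<Rightarrow> 'a \<Rightarrow> real" where "T1 \<equiv> real_cond_exp M F1"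
abbreviation T2 :: "('a \<Rightarrow> real) \<Rightarrow> 'a \<Rightarrow> real" where "T2 \<equiv> real_cond_exp M F2"
abbreviation H :: "'a measure" where "H \<equiv> inter_field M F1 F2"

lemma subalgebra_H: "subalgebra F1 H" "subalgebra F2 H" "subalgebra M H"
proof -
  have sp: "space H = space M" by (simp add: inter_field_def space_measure_of_conv)
  note sub = F1.subalg F2.subalg
  show "subalgebra F1 H" "subalgebra F2 H" "subalgebra M H"
    using sub sp sets_inter_field[OF sub] unfolding subalgebra_def by auto
qed

sublocale FH: prob_subalgebra M H
  using F1.prob_space_axioms subalgebra_H(3) by (rule prob_subalgebraI)

sublocale symmetric_markov_operator M "\<lambda>f. T1 (T2 (T1 f))"
proof
  fix f assume f: "square_integrable M f"
  note s = F1.CE_sq[OF f] F2.CE_sq[OF F1.CE_sq[OF f]]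
  show sq: "square_integrable M (T1 (T2 (T1 f)))" by (rule F1.CE_sq[OF s(2)])
  have "(\<integral>x. (T1 (T2 (T1 f)) x)\<^sup>2 \<partial>M) \<le> (\<integral>x. (T2 (T1 f) x)\<^sup>2 \<partial>M)"
    by (rule F1.CE_contraction[OF s(2)])
  also have "\<dots> = (\<integral>x. T2 (T1 f) x * T1 f x \<partial>M)"
    using F2.CE_inner[OF s(1) s(1)] by (simp add: power2_eq_square)
  also have "\<dots> = (\<integral>x. T1 (T2 (T1 f)) x * f x \<partial>M)"
    by (rule F1.CE_sym[OF s(2) f, symmetric])
  finally show "(\<integral>x. (T1 (T2 (T1 f)) x)\<^sup>2 \<partial>M) \<le> (\<integral>x. T1 (T2 (T1 f)) x * f x \<partial>M)" .
  fix g assume g: "square_integrable M g"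
  note t = F1.CE_sq[OF g] F2.CE_sq[OF F1.CE_sq[OF g]]
  show "(\<integral>x. T1 (T2 (T1 f)) x * g x \<partial>M) = (\<integral>x. f x * T1 (T2 (T1 g)) x \<partial>M)"
    using F1.CE_sym[OF s(2) g] F2.CE_sym[OF s(1) t(1)] F1.CE_sym[OF f t(2)] by simp
  show "AE x in M. T1 (T2 (T1 (\<lambda>x. f x + c * g x))) x = T1 (T2 (T1 f)) x + c * T1 (T2 (T1 g)) x" for c
  proof -
    note cg = square_integrable_cmult[of M _ c]
    note fg = square_integrable_add[OF f cg[OF g]]
    note a = F2.CE_cong[OF F1.CE_sq[OF fg] square_integrable_add[OF s(1) cg[OF t(1)]] F1.CE_lin[OF f g]]
    have "AE x in M. T2 (T1 (\<lambda>x. f x + c * g x)) x = T2 (T1 f) x + c * T2 (T1 g) x"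
      using a F2.CE_lin[OF s(1) t(1), of c] by eventually_elim simp
    from F1.CE_cong[OF F2.CE_sq[OF F1.CE_sq[OF fg]] square_integrable_add[OF s(2) cg[OF t(2)]] this]
      F1.CE_lin[OF s(2) t(2), of c]
    show ?thesis by eventually_elim simp
  qed
  assume le: "AE x in M. f x \<le> g x"
  note i = F1.square_integrable_imp_integrable
  show "AE x in M. T1 (T2 (T1 f)) x \<le> T1 (T2 (T1 g)) x"
    by (intro F1.real_cond_exp_mono F2.real_cond_exp_mono le i f g s t)
next
  note o = F1.square_integrable_const[of 1]
  have 1: "AE x in M. T1 (\<lambda>_. 1) x = 1" "AE x in M. T2 (\<lambda>_. 1) x = 1"
    by (intro F1.real_cond_exp_F_meas F2.real_cond_exp_F_meas; simp)+
  note a = F2.CE_cong[OF F1.CE_sq[OF o] o 1(1)]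
  have "AE x in M. T2 (T1 (\<lambda>_. 1)) x = 1" using a 1(2) by eventually_elim simp
  from F1.CE_cong[OF F2.CE_sq[OF F1.CE_sq[OF o]] o this] 1(1)
  show "AE x in M. T1 (T2 (T1 (\<lambda>_. 1))) x = 1" by eventually_elim simp
qed

lemma fixed_point_measurable:
  assumes g: "square_integrable M g" and fixed: "AE x in M. T1 (T2 (T1 g)) x = g x"
  shows "g \<in> borel_measurable H"
proof -
  note s = F1.CE_sq[OF g] F2.CE_sq[OF F1.CE_sq[OF g]]
  note [measurable] = g[THEN square_integrable_measurable]
  have eq: "(\<integral>x. (T1 (T2 (T1 g)) x)\<^sup>2 \<partial>M) = (\<integral>x. (g x)\<^sup>2 \<partial>M)"
    by (rule integral_cong_AE) (measurable, use fixed in auto)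
  note c = F1.CE_contraction[OF s(2)] F2.CE_contraction[OF s(1)] F1.CE_contraction[OF g]
  \<comment> \<open>\<open>A g = g\<close> forces equality throughout \<open>\<parallel>A g\<parallel> \<le> \<parallel>T2 T1 g\<parallel> \<le> \<parallel>T1 g\<parallel> \<le> \<parallel>g\<parallel>\<close>\<close>
  have "(\<integral>x. (T1 g x - g x)\<^sup>2 \<partial>M) \<le> 0"
    unfolding F1.CE_residual[OF g] using eq c by linarith
  then have 1: "AE x in M. T1 g x - g x = 0"
    by (rule integral_square_zero[OF square_integrable_diff[OF s(1) g]])
  have "(\<integral>x. (T2 (T1 g) x - T1 g x)\<^sup>2 \<partial>M) \<le> 0"
    unfolding F2.CE_residual[OF s(1)] using eq c by linarith
  then have 2: "AE x in M. T2 (T1 g) x - T1 g x = 0"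
    by (rule integral_square_zero[OF square_integrable_diff[OF s(2) s(1)]])
  have "g \<in> borel_measurable F1"
  proof (rule measurable_AE_eq[OF F1.subalg null1])
    show "AE x in M. g x = T1 g x" using 1 by eventually_elim simp
  qed simp_all
  moreover have "g \<in> borel_measurable F2"
  proof (rule measurable_AE_eq[OF F2.subalg null2])
    show "AE x in M. g x = T2 (T1 g) x" using 1 2 by eventually_elim simp
  qed simp_all
  moreover have "space F1 = space M" "space F2 = space M" "space H = space M"
    using F1.subalg F2.subalg subalgebra_H(3) by (simp_all add: subalgebra_def)
  ultimately show ?thesis
    unfolding measurable_def sets_inter_field[OF F1.subalg F2.subalg] by auto
qed

lemma CE_H_absorb:
  assumes f: "square_integrable M f"
  shows "AE x in M. real_cond_exp M H (T1 f) x = real_cond_exp M H f x"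
    and "AE x in M. real_cond_exp M H (T2 f) x = real_cond_exp M H f x"
  using FH.real_cond_exp_nested_subalg[OF F1.subalg subalgebra_H(1)]
    FH.real_cond_exp_nested_subalg[OF F2.subalg subalgebra_H(2)]
    F1.square_integrable_imp_integrable[OF f] by blast+

text \<open>The iterates \<open>T1 f, T1 T2 T1 f, ...\<close> agree almost everywhere with the powers of
  \<open>A = T1 T2 T1\<close> applied to \<open>T1 f\<close>, since \<open>T1\<close> is idempotent.\<close>
lemma alternating_converges:
  assumes f: "square_integrable M f"
  defines "s \<equiv> (\<lambda>n. ((\<lambda>h. T1 (T2 h)) ^^ n) (T1 f))"
  shows "square_integrable M (s n)"
    and "(\<lambda>n. \<integral>x. (s n x - real_cond_exp M H f x)\<^sup>2 \<partial>M) \<longlonglongrightarrow> 0"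
    and "AE x in M. (\<lambda>n. s n x) \<longlonglongrightarrow> real_cond_exp M H f x"
proof -
  let ?A = "\<lambda>f. T1 (T2 (T1 f))"
  define a where "a n = (?A ^^ n) (T1 f)" for n
  note T1f = F1.CE_sq[OF f]
  have a_sq: "square_integrable M (a n)" for n
    unfolding a_def by (rule pow_sq[OF T1f])
  have s_sq: "square_integrable M (s n)" for n
    unfolding s_def by (induction n) (simp_all add: T1f F1.CE_sq F2.CE_sq)
  then show "square_integrable M (s n)" .
  have T1s: "AE x in M. T1 (s n) x = s n x" for n
    unfolding s_def using F1.CE_idem[OF f] F1.CE_idem[OF F2.CE_sq[OF s_sq[unfolded s_def]]]
    by (cases n) simp_all
  have eq: "AE x in M. s n x = a n x" for n
  proof (induction n)
    case (Suc n)
    have "AE x in M. s n x = T1 (a n) x"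
      using T1s[of n] F1.CE_cong[OF s_sq a_sq Suc] by eventually_elim simp
    from F1.CE_cong[OF F2.CE_sq[OF s_sq] F2.CE_sq[OF F1.CE_sq[OF a_sq]]
        F2.CE_cong[OF s_sq F1.CE_sq[OF a_sq] this]]
    show ?case by (simp add: s_def a_def)
  qed (simp add: s_def a_def)
  obtain g where g: "square_integrable M g" "AE x in M. ?A g x = g x"
    and lim: "(\<lambda>n. \<integral>x. (a n x - g x)\<^sup>2 \<partial>M) \<longlonglongrightarrow> 0"
    unfolding a_def using pow_L2_converges[OF T1f] by blast
  note [measurable] = s_sq[THEN square_integrable_measurable] a_sq[THEN square_integrable_measurable]
    g(1)[THEN square_integrable_measurable]
  have Ha: "AE x in M. real_cond_exp M H (a n) x = real_cond_exp M H f x" for n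
  proof (induction n)
    case 0
    show ?case using CE_H_absorb(1)[OF f] by (simp add: a_def)
  next
    case (Suc n)
    from Suc CE_H_absorb(1)[OF a_sq[of n]] CE_H_absorb(2)[OF F1.CE_sq[OF a_sq[of n]]]
      CE_H_absorb(1)[OF F2.CE_sq[OF F1.CE_sq[OF a_sq[of n]]]]
    show ?case by eventually_elim (simp add: a_def)
  qed
  have "(\<lambda>n. \<integral>x. (real_cond_exp M H (a n) x - real_cond_exp M H g x)\<^sup>2 \<partial>M) \<longlonglongrightarrow> 0"
    by (rule FH.CE_L2_continuous[OF a_sq g(1) lim])
  moreover have "(\<integral>x. (real_cond_exp M H (a n) x - real_cond_exp M H g x)\<^sup>2 \<partial>M)
      = (\<integral>x. (real_cond_exp M H f x - real_cond_exp M H g x)\<^sup>2 \<partial>M)" for n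
    by (rule integral_cong_AE) (measurable, use Ha[of n] in auto)
  ultimately have "(\<integral>x. (real_cond_exp M H f x - real_cond_exp M H g x)\<^sup>2 \<partial>M) \<le> 0"
    by (simp add: LIMSEQ_const_iff)
  then have "AE x in M. real_cond_exp M H f x - real_cond_exp M H g x = 0"
    by (rule integral_square_zero[OF square_integrable_diff[OF FH.CE_sq[OF f] FH.CE_sq[OF g(1)]]])
  moreover have "AE x in M. real_cond_exp M H g x = g x"
    by (rule FH.real_cond_exp_F_meas[OF F1.square_integrable_imp_integrable[OF g(1)]
          fixed_point_measurable[OF g]])
  ultimately have gH: "AE x in M. g x = real_cond_exp M H f x" by eventually_elim simp
  have "(\<integral>x. (a n x - g x)\<^sup>2 \<partial>M) = (\<integral>x. (s n x - real_cond_exp M H f x)\<^sup>2 \<partial>M)" for n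
    by (rule integral_square_diff_cong[OF
          square_integrable_measurable[OF a_sq] square_integrable_measurable[OF g(1)]
          square_integrable_measurable[OF s_sq] borel_measurable_cond_exp2 AE_symmetric[OF eq] gH])
  with lim show "(\<lambda>n. \<integral>x. (s n x - real_cond_exp M H f x)\<^sup>2 \<partial>M) \<longlonglongrightarrow> 0" by simp
  have "AE x in M. (\<lambda>n. a n x) \<longlonglongrightarrow> g x"
    unfolding a_def by (rule pow_AE_converges[OF T1f g lim[unfolded a_def]])
  moreover have "AE x in M. \<forall>n. s n x = a n x"
    unfolding AE_all_countable using eq by blast
  ultimately show "AE x in M. (\<lambda>n. s n x) \<longlonglongrightarrow> real_cond_exp M H f x"
    using gH by eventually_elim simp
qed

end

lemma LIMSEQ_odd_even:
  fixes s :: "nat \<Rightarrow> real"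
  assumes odd: "(\<lambda>n. s (2 * n + 1)) \<longlonglongrightarrow> l" and even: "(\<lambda>n. s (2 * n + 2)) \<longlonglongrightarrow> l"
  shows "s \<longlonglongrightarrow> l"
proof (rule LIMSEQ_I)
  fix r :: real assume "r > 0"
  then obtain N1 N2 where N: "\<And>n. n \<ge> N1 \<Longrightarrow> norm (s (2 * n + 1) - l) < r"
    "\<And>n. n \<ge> N2 \<Longrightarrow> norm (s (2 * n + 2) - l) < r"
    using LIMSEQ_D[OF odd] LIMSEQ_D[OF even] by metis
  have "norm (s n - l) < r" if "n \<ge> 2 * N1 + 2 * N2 + 2" for n
  proof (cases "odd n")
    case True
    then obtain m where "n = 2 * m + 1" by (elim oddE)
    with N(1)[of m] that show ?thesis by simp
  next
    case False
    then obtain k where k: "n = 2 * k" by (auto elim: evenE)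
    with that have "k > 0" by simp
    then obtain m where "k = Suc m" using gr0_conv_Suc by blast
    with k N(2)[of m] that show ?thesis by simp
  qed
  then show "\<exists>N. \<forall>n\<ge>N. norm (s n - l) < r" by blast
qed

lemma iter_alt_cond_exp:
  "iter_ops (alt_cond_exp M G1 G2) (2 * n + 1) X
    = ((\<lambda>h. real_cond_exp M G1 (real_cond_exp M G2 h)) ^^ n) (real_cond_exp M G1 X)"
  "iter_ops (alt_cond_exp M G1 G2) (2 * n + 2) X
    = ((\<lambda>h. real_cond_exp M G2 (real_cond_exp M G1 h)) ^^ n) (real_cond_exp M G2 (real_cond_exp M G1 X))"
  by (induction n) (simp_all add: alt_cond_exp_def)

lemma iter_alt_cond_exp_sq:
  assumes "prob_space M" "subalgebra M G1" "subalgebra M G2" "square_integrable M X"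
  shows "square_integrable M (iter_ops (alt_cond_exp M G1 G2) n X)"
proof -
  interpret G1: prob_subalgebra M G1 using assms by (intro prob_subalgebraI)
  interpret G2: prob_subalgebra M G2 using assms by (intro prob_subalgebraI)
  show ?thesis
    by (induction n) (simp_all add: assms(4) alt_cond_exp_def G1.CE_sq G2.CE_sq)
qed

lemma iter_alt_cond_exp_null_completion:
  assumes "prob_space M" "subalgebra M G1" "subalgebra M G2" "square_integrable M X"
  shows "AE x in M. iter_ops (alt_cond_exp M G1 G2) n X x
    = iter_ops (alt_cond_exp M (null_completion M G1) (null_completion M G2)) n X x"
proof (induction n)
  case (Suc n)
  let ?F1 = "null_completion M G1" and ?F2 = "null_completion M G2"
  let ?s = "iter_ops (alt_cond_exp M G1 G2) n X" and ?t = "iter_ops (alt_cond_exp M ?F1 ?F2) n X"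
  note F = subalgebra_null_completion[OF assms(2)] subalgebra_null_completion[OF assms(3)]
  interpret G1: prob_subalgebra M G1 using assms by (intro prob_subalgebraI)
  interpret G2: prob_subalgebra M G2 using assms by (intro prob_subalgebraI)
  note s = iter_alt_cond_exp_sq[OF assms, of n]
  note t = iter_alt_cond_exp_sq[OF assms(1) F assms(4), of n]
  have "AE x in M. real_cond_exp M G1 ?s x = real_cond_exp M ?F1 ?t x"
    using G1.CE_cong[OF s t Suc] real_cond_exp_null_completion[OF assms(1,2) t]
    by eventually_elim simp
  moreover have "AE x in M. real_cond_exp M G2 ?s x = real_cond_exp M ?F2 ?t x"
    using G2.CE_cong[OF s t Suc] real_cond_exp_null_completion[OF assms(1,3) t]
    by eventually_elim simp
  ultimately show ?case
    by (cases "even n") (simp_all add: alt_cond_exp_def[of M _ _ "Suc n"])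
qed simp

theorem theorem3p1:
  fixes M G1 G2 :: "'a measure" and X :: "'a \<Rightarrow> real"
  assumes "prob_space M"
    and "subalgebra M G1" and "subalgebra M G2"
    and "square_integrable M X"
  shows
    "L2_converges M (\<lambda>n. iter_ops (alt_cond_exp M G1 G2) n X)
       (real_cond_exp M (inter_field M (null_completion M G1) (null_completion M G2)) X)
     \<and> (AE x in M. (\<lambda>n. iter_ops (alt_cond_exp M G1 G2) n X x) \<longlonglongrightarrow>
       real_cond_exp M (inter_field M (null_completion M G1) (null_completion M G2)) X x)"
proof -
  define F1 F2 where "F1 = null_completion M G1" and "F2 = null_completion M G2"
  note F = subalgebra_null_completion[OF assms(2), folded F1_def]
    subalgebra_null_completion[OF assms(3), folded F2_def]
  have null: "null_sets M \<subseteq> sets F1" "null_sets M \<subseteq> sets F2"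
    unfolding F1_def F2_def sets_null_completion[OF assms(2)] sets_null_completion[OF assms(3)] by auto
  interpret F12: two_subalgebras M F1 F2
    by (intro two_subalgebras.intro two_subalgebras_axioms.intro prob_subalgebraI assms(1) F null)
  interpret F21: two_subalgebras M F2 F1
    by (intro two_subalgebras.intro two_subalgebras_axioms.intro prob_subalgebraI assms(1) F null)
  define L where "L = real_cond_exp M (inter_field M F1 F2) X"
  define S where "S n = iter_ops (alt_cond_exp M G1 G2) n X" for n
  define S' where "S' n = iter_ops (alt_cond_exp M F1 F2) n X" for n
  note X = assms(4)
  have H: "inter_field M F2 F1 = inter_field M F1 F2"
    by (simp add: inter_field_def Int_commute)
  have T1X: "square_integrable M (real_cond_exp M F1 X)" by (rule F12.F1.CE_sq[OF X])
  have L_sq: "square_integrable M L" unfolding L_def by (rule F12.FH.CE_sq[OF X])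
  have S_sq: "square_integrable M (S n)" for n
    unfolding S_def by (rule iter_alt_cond_exp_sq[OF assms])
  have S'_sq: "square_integrable M (S' n)" for n
    unfolding S'_def by (rule iter_alt_cond_exp_sq[OF assms(1) F assms(4)])
  have eq: "AE x in M. S n x = S' n x" for n
    unfolding S_def S'_def F1_def F2_def by (rule iter_alt_cond_exp_null_completion[OF assms])
  note [measurable] = S_sq[THEN square_integrable_measurable] S'_sq[THEN square_integrable_measurable]
    L_sq[THEN square_integrable_measurable]
  \<comment> \<open>the iterates of even index start from \<open>T2 (T1 X)\<close>, so their limit arises as the
    projection of \<open>T1 X\<close>\<close>
  have LT1: "AE x in M. real_cond_exp M (inter_field M F1 F2) (real_cond_exp M F1 X) x = L x"
    unfolding L_def by (rule F12.CE_H_absorb(1)[OF X])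
  have even_eq: "(\<integral>x. (S' (2 * n + 2) x - real_cond_exp M (inter_field M F1 F2) (real_cond_exp M F1 X) x)\<^sup>2 \<partial>M)
      = (\<integral>x. (S' (2 * n + 2) x - L x)\<^sup>2 \<partial>M)" for n
    by (rule integral_square_diff_cong[OF
          square_integrable_measurable[OF S'_sq] borel_measurable_cond_exp2
          square_integrable_measurable[OF S'_sq] square_integrable_measurable[OF L_sq] AE_I2[OF refl] LT1])
  have "(\<lambda>n. \<integral>x. (S' n x - L x)\<^sup>2 \<partial>M) \<longlonglongrightarrow> 0"
  proof (rule LIMSEQ_odd_even)
    show "(\<lambda>n. \<integral>x. (S' (2 * n + 1) x - L x)\<^sup>2 \<partial>M) \<longlonglongrightarrow> 0"
      unfolding S'_def iter_alt_cond_exp L_def by (rule F12.alternating_converges(2)[OF X])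
    show "(\<lambda>n. \<integral>x. (S' (2 * n + 2) x - L x)\<^sup>2 \<partial>M) \<longlonglongrightarrow> 0"
      unfolding even_eq[symmetric] unfolding S'_def iter_alt_cond_exp
      using F21.alternating_converges(2)[OF T1X] unfolding H .
  qed
  moreover have "(\<integral>x. (S' n x - L x)\<^sup>2 \<partial>M) = (\<integral>x. (S n x - L x)\<^sup>2 \<partial>M)" for n
    by (rule integral_square_diff_cong[OF
          square_integrable_measurable[OF S'_sq] square_integrable_measurable[OF L_sq]
          square_integrable_measurable[OF S_sq] square_integrable_measurable[OF L_sq]
          AE_symmetric[OF eq] AE_I2[OF refl]])
  ultimately have "(\<lambda>n. sqrt (\<integral>x. (S n x - L x)\<^sup>2 \<partial>M)) \<longlonglongrightarrow> sqrt 0"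
    by (intro tendsto_real_sqrt) simp
  then have "L2_converges M S L"
    unfolding L2_converges_def L2_norm_on_def using S_sq L_sq by simp
  moreover have "AE x in M. (\<lambda>n. S n x) \<longlonglongrightarrow> L x"
  proof -
    have "AE x in M. (\<lambda>n. S' (2 * n + 1) x) \<longlonglongrightarrow> L x"
      unfolding S'_def iter_alt_cond_exp L_def by (rule F12.alternating_converges(3)[OF X])
    moreover have "AE x in M. (\<lambda>n. S' (2 * n + 2) x)
        \<longlonglongrightarrow> real_cond_exp M (inter_field M F1 F2) (real_cond_exp M F1 X) x"
      unfolding S'_def iter_alt_cond_exp
      using F21.alternating_converges(3)[OF T1X] unfolding H .
    moreover have "AE x in M. \<forall>n. S n x = S' n x"
      unfolding AE_all_countable using eq by blast
    ultimately show ?thesis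
      using LT1
    proof eventually_elim
      case (elim x)
      have "(\<lambda>n. S' n x) \<longlonglongrightarrow> L x"
        by (rule LIMSEQ_odd_even[OF elim(1) elim(2)[unfolded elim(4)]])
      with elim show ?case by simp
    qed
  qed
  ultimately show ?thesis unfolding S_def L_def F1_def F2_def by blast
qed

end
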